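(* There exists a function $f:\mathbb{N}\times\mathbb{N}\to\mathbb{N}$ such that for every $d,k\in\mathbb{N}$ and every matrix $A$ over $\mathbb{Q}$ of entry complexity $k$ whose column matroid $M=M(A)$ satisfies $\mathrm{csd}(M)=d$ and $\mathrm{csd}(M\setminus e)<d$ for every element $e$ of $M$, we have $|M|\le f(d,k)$.
   Context: The entry complexity of a rational matrix is the maximum, over its entries $r=p/q$ with $p,q$ coprime, of the binary encoding length $\lceil\log_2(|p|+1)\rceil+\lceil\log_2(|q|+1)\rceil$. For a matrix $A$ with $m$ rows and a subspace $K\subseteq\mathbb{Q}^m$, $M(A,K)$ is the matroid on the columns where $\{u_1,\dots,u_\ell\}$ is dependent iff $\sum\alpha_iu_i\in K$ for some $\alpha_i$ not all $0$; $M(A)=M(A,\{0\})$. Connected: any two elements lie in a common circuit; components: maximal connected restrictions. $\mathrm{csd}(A,K)=0$ if $M(A,K)$ has rank $0$; otherwise if disconnected, $\mathrm{csd}(A,K)=\max_C\mathrm{csd}(A_C,K)$ over components $C$ ($A_C$ the submatrix of columns of $C$); otherwise $\mathrm{csd}(A,K)=1+\min_{v\in\mathbb{Q}^m}\mathrm{csd}(A,K+\mathrm{span}(v))$. $\mathrm{csd}(M(A))=\mathrm{csd}(A,\{0\})$; $M\setminus e$ is represented by $A$ with column $e$ removed. *)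

theory Defs
  imports Complex_Main
begin

text \<open>A rational matrix with m rows and n columns is given by m, n and
  A :: nat => nat => rat, where A i j is the entry in row i, column j
  (only i < m, j < n are relevant). Vectors of Q^m are functions nat => rat
  vanishing from index m on. Matroid elements are column indices.\<close>

definition bitlen :: "int \<Rightarrow> nat" where
  "bitlen x = nat \<lceil>log 2 (real_of_int (\<bar>x\<bar> + 1))\<rceil>"

definition rat_enc :: "rat \<Rightarrow> nat" where
  "rat_enc r = (case quotient_of r of (p, q) \<Rightarrow> bitlen p + bitlen q)"

definition entry_complexity :: "nat \<Rightarrow> nat \<Rightarrow> (nat \<Rightarrow> nat \<Rightarrow> rat) \<Rightarrow> nat" where
  "entry_complexity m n A = Max ({0} \<union> {rat_enc (A i j) | i j. i < m \<and> j < n})"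

definition col :: "nat \<Rightarrow> (nat \<Rightarrow> nat \<Rightarrow> rat) \<Rightarrow> nat \<Rightarrow> nat \<Rightarrow> rat" where
  "col m A j = (\<lambda>i. if i < m then A i j else 0)"

definition mdep :: "nat \<Rightarrow> (nat \<Rightarrow> nat \<Rightarrow> rat) \<Rightarrow> (nat \<Rightarrow> rat) set \<Rightarrow> nat set \<Rightarrow> bool" where
  "mdep m A K X \<longleftrightarrow> (\<exists>\<alpha>. (\<exists>j\<in>X. \<alpha> j \<noteq> 0) \<and> (\<lambda>i. \<Sum>j\<in>X. \<alpha> j * col m A j i) \<in> K)"

definition mrank :: "nat \<Rightarrow> (nat \<Rightarrow> nat \<Rightarrow> rat) \<Rightarrow> (nat \<Rightarrow> rat) set \<Rightarrow> nat set \<Rightarrow> nat" where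
  "mrank m A K E = Max {card X | X. X \<subseteq> E \<and> \<not> mdep m A K X}"

definition mcircuit :: "nat \<Rightarrow> (nat \<Rightarrow> nat \<Rightarrow> rat) \<Rightarrow> (nat \<Rightarrow> rat) set \<Rightarrow> nat set \<Rightarrow> nat set \<Rightarrow> bool" where
  "mcircuit m A K E C \<longleftrightarrow> C \<subseteq> E \<and> mdep m A K C \<and> (\<forall>Y. Y \<subset> C \<longrightarrow> \<not> mdep m A K Y)"

definition mconnected :: "nat \<Rightarrow> (nat \<Rightarrow> nat \<Rightarrow> rat) \<Rightarrow> (nat \<Rightarrow> rat) set \<Rightarrow> nat set \<Rightarrow> bool" where
  "mconnected m A K E \<longleftrightarrow>
     (\<forall>e\<in>E. \<forall>f\<in>E. e \<noteq> f \<longrightarrow> (\<exists>C. mcircuit m A K E C \<and> e \<in> C \<and> f \<in> C))"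

definition mcomponents :: "nat \<Rightarrow> (nat \<Rightarrow> nat \<Rightarrow> rat) \<Rightarrow> (nat \<Rightarrow> rat) set \<Rightarrow> nat set \<Rightarrow> nat set set" where
  "mcomponents m A K E =
     {{f \<in> E. e = f \<or> (\<exists>C. mcircuit m A K E C \<and> e \<in> C \<and> f \<in> C)} | e. e \<in> E}"

definition Kplus :: "(nat \<Rightarrow> rat) set \<Rightarrow> (nat \<Rightarrow> rat) \<Rightarrow> (nat \<Rightarrow> rat) set" where
  "Kplus K v = {(\<lambda>i. x i + c * v i) | x c. x \<in> K}"

inductive csd_le :: "nat \<Rightarrow> (nat \<Rightarrow> nat \<Rightarrow> rat) \<Rightarrow> (nat \<Rightarrow> rat) set \<Rightarrow> nat set \<Rightarrow> nat \<Rightarrow> bool"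
  for m A where
  rank0: "mrank m A K E = 0 \<Longrightarrow> csd_le m A K E d"
| disconn: "mrank m A K E > 0 \<Longrightarrow> \<not> mconnected m A K E \<Longrightarrow>
     (\<forall>C\<in>mcomponents m A K E. csd_le m A K C d) \<Longrightarrow> csd_le m A K E d"
| conn: "mrank m A K E > 0 \<Longrightarrow> mconnected m A K E \<Longrightarrow> (\<forall>i\<ge>m. v i = 0) \<Longrightarrow>
     csd_le m A (Kplus K v) E d \<Longrightarrow> csd_le m A K E (Suc d)"

definition csd :: "nat \<Rightarrow> (nat \<Rightarrow> nat \<Rightarrow> rat) \<Rightarrow> nat set \<Rightarrow> nat" where
  "csd m A E = (LEAST d. csd_le m A {(\<lambda>i. 0)} E d)"

end

theory Submission
  imports Defs "HOL-Library.Ramsey" "HOL-Library.Sublist"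
begin

text \<open>
  Contracting a subspace \<open>K\<close> only matters through the space of coefficient vectors \<open>\<alpha>\<close> with
  \<open>\<Sum>j. \<alpha> j * col m A j \<in> K\<close>, and in these terms \<open>csd\<close> is the least depth of a decomposition
  that alternates between separating the elements and adding an arbitrary vector to the
  dependency space. Circuits of a matroid of depth \<open>d\<close> have at most \<open>2 ^ d\<close> elements. An
  inseparable matroid that separates after a few vector contractions has a circuit crossing the
  separation, and contracting the part of it on one side saves one of the vectors. So depth \<open>d\<close>
  yields a decomposition, of depth bounded in \<open>d\<close>, that contracts columns of \<open>A\<close> only.

  In such a decomposition a leaf is a column together with boundedly many contracted columns, and
  its linear dependencies are determined by the set of rows of this small matrix, for which there
  are finitely many possibilities once the entries range over a finite set. By Higman's lemma,
  applied once per layer, these decompositions are well-quasi-ordered under embeddings that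
  preserve and reflect linear dependencies. Hence among infinitely many critical matrices of
  distinct sizes one would be isomorphic to a proper restriction of another, which contradicts
  monotonicity of \<open>csd\<close>.
\<close>

subsection \<open>Dependency spaces and decompositions\<close>

definition rs :: "nat set \<Rightarrow> (nat \<Rightarrow> rat) \<Rightarrow> nat \<Rightarrow> rat" where
  "rs E \<alpha> = (\<lambda>j. if j \<in> E then \<alpha> j else 0)"

definition unitv :: "nat \<Rightarrow> nat \<Rightarrow> rat" where
  "unitv e = (\<lambda>j. if j = e then 1 else 0)"

definition subsp :: "(nat \<Rightarrow> rat) set \<Rightarrow> bool" where
  "subsp D \<longleftrightarrow> (\<lambda>_. 0) \<in> D \<and> (\<forall>\<alpha>\<in>D. \<forall>\<beta>\<in>D. \<forall>c. (\<lambda>j. \<alpha> j + c * \<beta> j) \<in> D)"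

text \<open>Direct sum: every dependency supported on \<open>E1 \<union> E2\<close> is the sum of
  one supported on \<open>E1\<close> and one supported on \<open>E2\<close>, the latter obtained by
  subtraction.\<close>

definition separates :: "(nat \<Rightarrow> rat) set \<Rightarrow> nat set \<Rightarrow> nat set \<Rightarrow> bool" where
  "separates D E1 E2 \<longleftrightarrow>
     E1 \<inter> E2 = {} \<and> (\<forall>\<alpha>. rs (E1 \<union> E2) \<alpha> \<in> D \<longrightarrow> rs E1 \<alpha> \<in> D)"

section \<open>Subspaces of coefficient vectors and their extension by one vector\<close>

lemma subsp_zero: "subsp D \<Longrightarrow> (\<lambda>_. 0) \<in> D"
  by (simp add: subsp_def)

lemma subsp_add_scale: "subsp D \<Longrightarrow> \<alpha> \<in> D \<Longrightarrow> \<beta> \<in> D \<Longrightarrow> (\<lambda>j. \<alpha> j + c * \<beta> j) \<in> D"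
  by (simp add: subsp_def)

lemma subsp_scale: "subsp D \<Longrightarrow> \<alpha> \<in> D \<Longrightarrow> (\<lambda>j. c * \<alpha> j) \<in> D"
  using subsp_add_scale[of D "\<lambda>_. 0" \<alpha> c] by (simp add: subsp_zero)

lemma subsp_diff: "subsp D \<Longrightarrow> \<alpha> \<in> D \<Longrightarrow> \<beta> \<in> D \<Longrightarrow> (\<lambda>j. \<alpha> j - \<beta> j) \<in> D"
  using subsp_add_scale[of D \<alpha> \<beta> "-1"] by simp

lemma subsp_diff_scale:
  "subsp D \<Longrightarrow> \<alpha> \<in> D \<Longrightarrow> \<beta> \<in> D \<Longrightarrow> (\<lambda>j. \<alpha> j - c * \<beta> j) \<in> D"
  using subsp_add_scale[of D \<alpha> \<beta> "- c"] by simp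

lemma subsp_add_cancel:
  assumes "subsp D" "\<beta> \<in> D"
  shows "(\<lambda>j. \<alpha> j + c * \<beta> j) \<in> D \<longleftrightarrow> \<alpha> \<in> D"
  using subsp_add_scale[OF assms(1) _ assms(2), of \<alpha> c]
    subsp_diff_scale[OF assms(1) _ assms(2), of "\<lambda>j. \<alpha> j + c * \<beta> j" c] by auto

lemma mem_Kplus: "\<alpha> \<in> Kplus D v \<longleftrightarrow> (\<exists>c. (\<lambda>j. \<alpha> j - c * v j) \<in> D)"
proof
  assume "\<alpha> \<in> Kplus D v"
  then obtain x c where "x \<in> D" "\<alpha> = (\<lambda>i. x i + c * v i)" by (auto simp: Kplus_def)
  then show "\<exists>c. (\<lambda>j. \<alpha> j - c * v j) \<in> D" by (intro exI[of _ c]) simp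
next
  assume "\<exists>c. (\<lambda>j. \<alpha> j - c * v j) \<in> D"
  then obtain c where c: "(\<lambda>j. \<alpha> j - c * v j) \<in> D" ..
  show "\<alpha> \<in> Kplus D v"
    unfolding Kplus_def mem_Collect_eq
    by (intro exI[of _ "\<lambda>j. \<alpha> j - c * v j"] exI[of _ c] conjI c) auto
qed

lemma Kplus_superset: "D \<subseteq> Kplus D v"
proof
  fix \<alpha> assume "\<alpha> \<in> D"
  then show "\<alpha> \<in> Kplus D v" unfolding mem_Kplus by (intro exI[of _ 0]) simp
qed

lemma Kplus_self: "subsp D \<Longrightarrow> v \<in> Kplus D v"
  unfolding mem_Kplus by (intro exI[of _ 1]) (simp add: subsp_zero)

lemma subsp_Kplus:
  assumes "subsp D" shows "subsp (Kplus D v)"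
  unfolding subsp_def
proof (intro conjI ballI allI)
  show "(\<lambda>_. 0) \<in> Kplus D v" using Kplus_superset subsp_zero[OF assms] by blast
next
  fix \<alpha> \<beta> c assume "\<alpha> \<in> Kplus D v" "\<beta> \<in> Kplus D v"
  then obtain a b where a: "(\<lambda>j. \<alpha> j - a * v j) \<in> D" and b: "(\<lambda>j. \<beta> j - b * v j) \<in> D"
    unfolding mem_Kplus by blast
  have "(\<lambda>j. (\<alpha> j + c * \<beta> j) - (a + c * b) * v j) \<in> D"
    using subsp_add_scale[OF assms a b, of c] by (simp add: algebra_simps)
  then show "(\<lambda>j. \<alpha> j + c * \<beta> j) \<in> Kplus D v" unfolding mem_Kplus by blast
qed

lemma Kplus_commute: "Kplus (Kplus D v) w = Kplus (Kplus D w) v"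
proof -
  have "Kplus (Kplus D v) w \<subseteq> Kplus (Kplus D w) v" for v w
  proof
    fix \<alpha> assume "\<alpha> \<in> Kplus (Kplus D v) w"
    then obtain a b where "(\<lambda>j. \<alpha> j - a * w j - b * v j) \<in> D" by (auto simp: mem_Kplus)
    then have "(\<lambda>j. \<alpha> j - b * v j - a * w j) \<in> D" by (simp add: algebra_simps)
    then show "\<alpha> \<in> Kplus (Kplus D w) v" unfolding mem_Kplus by blast
  qed
  then show ?thesis by blast
qed

lemma Kplus_absorb:
  assumes "subsp D" "v \<in> D" shows "Kplus D v = D"
proof -
  have "\<alpha> \<in> Kplus D v \<longleftrightarrow> \<alpha> \<in> D" for \<alpha>
    using subsp_add_cancel[OF assms, of \<alpha> "- c" for c] by (simp add: mem_Kplus)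
  then show ?thesis by blast
qed

lemma Kplus_least: "subsp D' \<Longrightarrow> D \<subseteq> D' \<Longrightarrow> v \<in> D' \<Longrightarrow> Kplus D v \<subseteq> D'"
  by (auto simp: Kplus_def intro: subsp_add_scale)

text \<open>Steinitz exchange for one vector: as \<open>w\<close> is outside \<open>D\<close>, the
  coefficient of \<open>v\<close> in \<open>w\<close> is nonzero, so \<open>v\<close> can be
  expressed by \<open>w\<close> modulo \<open>D\<close>.\<close>

lemma Kplus_exchange:
  assumes "subsp D" "w \<in> Kplus D v" "w \<notin> D" shows "Kplus D w = Kplus D v"
proof
  show "Kplus D w \<subseteq> Kplus D v"
    by (rule Kplus_least[OF subsp_Kplus[OF assms(1)] Kplus_superset assms(2)])
  obtain c where c: "(\<lambda>j. w j - c * v j) \<in> D" using assms(2) by (auto simp: mem_Kplus)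
  with assms(3) have "c \<noteq> 0" by auto
  then have "(\<lambda>j. v j - (1 / c) * w j) = (\<lambda>j. (- 1 / c) * (w j - c * v j))"
    by (auto simp: field_simps)
  also have "\<dots> \<in> D" by (rule subsp_scale[OF assms(1) c])
  finally have "v \<in> Kplus D w" unfolding mem_Kplus by blast
  then show "Kplus D v \<subseteq> Kplus D w"
    by (rule Kplus_least[OF subsp_Kplus[OF assms(1)] Kplus_superset])
qed

section \<open>Restriction of coefficient vectors and separation of element sets\<close>

lemma rs_rs [simp]: "rs E (rs F \<alpha>) = rs (E \<inter> F) \<alpha>"
  by (auto simp: rs_def)

lemma rs_linear: "rs E (\<lambda>j. \<alpha> j - c * \<beta> j) = (\<lambda>j. rs E \<alpha> j - c * rs E \<beta> j)"
  by (auto simp: rs_def)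

lemma subsp_rs_preimage: "subsp D \<Longrightarrow> subsp {\<alpha>. rs E \<alpha> \<in> D}"
proof -
  assume D: "subsp D"
  have "rs E (\<lambda>j. \<alpha> j + c * \<beta> j) = (\<lambda>j. rs E \<alpha> j + c * rs E \<beta> j)" for \<alpha> \<beta> c
    by (auto simp: rs_def)
  moreover have "rs E (\<lambda>_. 0) = (\<lambda>_. 0)" by (auto simp: rs_def)
  ultimately show ?thesis using D by (simp add: subsp_def)
qed

lemma rs_unitv [simp]: "e \<in> E \<Longrightarrow> rs E (unitv e) = unitv e"
  by (auto simp: rs_def unitv_def)

lemma rs_empty [simp]: "rs {} \<alpha> = (\<lambda>_. 0)"
  by (auto simp: rs_def)

lemma rs_in_of_units:
  assumes "subsp D" "finite E" "\<forall>e\<in>E. unitv e \<in> D" shows "rs E \<alpha> \<in> D"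
  using assms(2,3)
proof (induction E rule: finite_induct)
  case empty
  then show ?case by (simp add: subsp_zero assms(1))
next
  case (insert e E)
  have "rs (insert e E) \<alpha> = (\<lambda>j. rs E \<alpha> j + \<alpha> e * unitv e j)"
    using insert(2) by (auto simp: rs_def unitv_def)
  then show ?case using insert subsp_add_scale[OF assms(1)] by auto
qed

lemma separates_commute:
  assumes "subsp D" "separates D E1 E2" shows "separates D E2 E1"
  unfolding separates_def
proof (intro conjI allI impI)
  show dis: "E2 \<inter> E1 = {}" using assms by (auto simp: separates_def)
  fix \<alpha> assume a: "rs (E2 \<union> E1) \<alpha> \<in> D"
  then have "rs E1 \<alpha> \<in> D" using assms by (simp add: separates_def Un_commute)
  from subsp_diff[OF assms(1) a this]
  have "(\<lambda>j. rs (E2 \<union> E1) \<alpha> j - rs E1 \<alpha> j) \<in> D" .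
  also have "(\<lambda>j. rs (E2 \<union> E1) \<alpha> j - rs E1 \<alpha> j) = rs E2 \<alpha>" using dis by (fastforce simp: rs_def fun_eq_iff)
  finally show "rs E2 \<alpha> \<in> D" .
qed

lemma separates_mono:
  assumes "separates D E1 E2" "F1 \<subseteq> E1" "F2 \<subseteq> E2" shows "separates D F1 F2"
  unfolding separates_def
proof (intro conjI allI impI)
  show "F1 \<inter> F2 = {}" using assms by (auto simp: separates_def)
  fix \<alpha> assume "rs (F1 \<union> F2) \<alpha> \<in> D"
  moreover have "(E1 \<union> E2) \<inter> (F1 \<union> F2) = F1 \<union> F2" "E1 \<inter> (F1 \<union> F2) = F1"
    using assms by (auto simp: separates_def)
  ultimately show "rs F1 \<alpha> \<in> D"
    using assms(1) unfolding separates_def by (metis rs_rs)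
qed

text \<open>A relaxed form of \<open>csd_le\<close>: any separation may be used, not only the one
  into components, and contraction is allowed at any time. This freedom makes restriction and
  transport along bijections easy. A leaf is a set of loops, that is, a set of rank 0.\<close>

inductive cdepth :: "(nat \<Rightarrow> rat) set \<Rightarrow> nat set \<Rightarrow> nat \<Rightarrow> bool" where
  leaf: "\<forall>e\<in>E. unitv e \<in> D \<Longrightarrow> cdepth D E d"
| split: "separates D E1 E2 \<Longrightarrow> cdepth D E1 d \<Longrightarrow> cdepth D E2 d \<Longrightarrow> cdepth D (E1 \<union> E2) d"
| contract: "cdepth (Kplus D v) E d \<Longrightarrow> cdepth D E (Suc d)"

lemma cdepth_subset: "cdepth D E d \<Longrightarrow> F \<subseteq> E \<Longrightarrow> cdepth D F d"
proof (induction arbitrary: F rule: cdepth.induct)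
  case (split D E1 E2 d)
  have "cdepth D ((F \<inter> E1) \<union> (F \<inter> E2)) d"
    by (intro cdepth.split split.IH separates_mono[OF split.hyps(1)]) auto
  moreover have "(F \<inter> E1) \<union> (F \<inter> E2) = F" using split.prems by auto
  ultimately show ?case by simp
qed (auto intro: cdepth.intros)

text \<open>Depth is determined by the dependencies supported on the element set, so it is invariant
  under bijections that match these dependencies.\<close>

lemma cdepth_pullback:
  assumes "cdepth D' E' d" "subsp D'" "subsp D" "inj_on \<iota> E" "\<iota> ` E = E'"
    "\<And>\<alpha>. rs E' \<alpha> \<in> D' \<longleftrightarrow> rs E (\<lambda>j. \<alpha> (\<iota> j)) \<in> D"
  shows "cdepth D E d"
  using assms
proof (induction arbitrary: D E rule: cdepth.induct)
  case (leaf E' D' d)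
  show ?case
  proof (rule cdepth.leaf, rule ballI)
    fix e assume e: "e \<in> E"
    then have "\<iota> e \<in> E'" using leaf.prems(4) by blast
    then have "rs E' (unitv (\<iota> e)) \<in> D'" using leaf.hyps by simp
    then have "rs E (\<lambda>j. unitv (\<iota> e) (\<iota> j)) \<in> D" unfolding leaf.prems(5) .
    also have "rs E (\<lambda>j. unitv (\<iota> e) (\<iota> j)) = unitv e"
      using leaf.prems(3) e by (auto simp: rs_def unitv_def fun_eq_iff inj_on_def)
    finally show "unitv e \<in> D" .
  qed
next
  case (split D' E1' E2' d)
  define E1 where "E1 = {e \<in> E. \<iota> e \<in> E1'}"
  define E2 where "E2 = {e \<in> E. \<iota> e \<in> E2'}"
  have E: "E = E1 \<union> E2" using split.prems by (auto simp: E1_def E2_def)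
  have im: "\<iota> ` E1 = E1'" "\<iota> ` E2 = E2'" using split.prems by (auto simp: E1_def E2_def)
  have pb: "rs F' \<alpha> \<in> D' \<longleftrightarrow> rs {e \<in> E. \<iota> e \<in> F'} (\<lambda>j. \<alpha> (\<iota> j)) \<in> D" if "F' \<subseteq> E1' \<union> E2'" for F' \<alpha>
  proof -
    have "rs F' \<alpha> = rs (E1' \<union> E2') (rs F' \<alpha>)" using that by (simp add: Int_absorb1)
    moreover have "rs E (\<lambda>j. rs F' \<alpha> (\<iota> j)) = rs {e \<in> E. \<iota> e \<in> F'} (\<lambda>j. \<alpha> (\<iota> j))"
      by (auto simp: rs_def)
    ultimately show ?thesis using split.prems(5)[of "rs F' \<alpha>"] by simp
  qed
  have "separates D E1 E2" unfolding separates_def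
  proof (intro conjI allI impI)
    show "E1 \<inter> E2 = {}" using split.hyps(1) by (auto simp: E1_def E2_def separates_def)
    fix \<beta> assume b: "rs (E1 \<union> E2) \<beta> \<in> D"
    define \<alpha> where "\<alpha> = (\<lambda>j. \<beta> (inv_into E \<iota> j))"
    have ab: "rs F (\<lambda>j. \<alpha> (\<iota> j)) = rs F \<beta>" if "F \<subseteq> E" for F
      using that split.prems(3) by (auto simp: rs_def \<alpha>_def fun_eq_iff subset_iff)
    have "rs (E1' \<union> E2') \<alpha> \<in> D'" using split.prems(5)[of \<alpha>] b ab[of E] E by simp
    then have "rs E1' \<alpha> \<in> D'" using split.hyps(1) by (simp add: separates_def)
    then have "rs E1 (\<lambda>j. \<alpha> (\<iota> j)) \<in> D" using pb[of E1' \<alpha>] by (simp add: E1_def)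
    then show "rs E1 \<beta> \<in> D" using ab[of E1] E by simp
  qed
  moreover have "cdepth D E1 d"
    using split.prems im pb[of E1'] by (intro split.IH(1)) (auto simp: E1_def inj_on_def)
  moreover have "cdepth D E2 d"
    using split.prems im pb[of E2'] by (intro split.IH(2)) (auto simp: E2_def inj_on_def)
  ultimately show ?case unfolding E by (rule cdepth.split)
next
  case (contract D' v E' d)
  note sub = subsp_Kplus[OF contract.prems(1), of v]
  \<comment> \<open>The vector \<open>v\<close> need not be supported on \<open>E'\<close>. If
    adding it creates a new dependency supported on \<open>E'\<close>, that dependency replaces
    \<open>v\<close> by exchange and is pulled back along \<open>\<iota>\<close>. Otherwise the
    contraction is invisible on \<open>E'\<close>, and the zero vector serves.\<close>
  have "\<exists>w. \<forall>\<alpha>. rs E' \<alpha> \<in> Kplus D' v \<longleftrightarrow> rs E (\<lambda>j. \<alpha> (\<iota> j)) \<in> Kplus D w"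
  proof (cases "\<exists>\<alpha>. rs E' \<alpha> \<in> Kplus D' v - D'")
    case True
    then obtain \<gamma> where g: "rs E' \<gamma> \<in> Kplus D' v" "rs E' \<gamma> \<notin> D'" by blast
    then have K: "Kplus D' v = Kplus D' (rs E' \<gamma>)" using Kplus_exchange contract.prems(1) by blast
    have "rs E' \<alpha> \<in> Kplus D' v \<longleftrightarrow> rs E (\<lambda>j. \<alpha> (\<iota> j)) \<in> Kplus D (rs E (\<lambda>j. \<gamma> (\<iota> j)))" for \<alpha>
      unfolding K mem_Kplus
      using contract.prems(5)[of "\<lambda>j. \<alpha> j - c * \<gamma> j" for c] by (simp add: rs_linear)
    then show ?thesis by blast
  next
    case False
    then have "rs E' \<alpha> \<in> Kplus D' v \<longleftrightarrow> rs E' \<alpha> \<in> D'" for \<alpha>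
      using Kplus_superset by blast
    then show ?thesis
      using contract.prems(5) by (intro exI[of _ "\<lambda>_. 0"])
        (simp add: Kplus_absorb subsp_zero contract.prems)
  qed
  then obtain w where w: "\<And>\<alpha>. rs E' \<alpha> \<in> Kplus D' v \<longleftrightarrow> rs E (\<lambda>j. \<alpha> (\<iota> j)) \<in> Kplus D w" by blast
  have "cdepth (Kplus D w) E d"
    using contract.IH[OF sub subsp_Kplus contract.prems(3,4) w] contract.prems(2) by blast
  then show ?case by (rule cdepth.contract)
qed

lemma cdepth_cong:
  assumes "cdepth D' E d" "subsp D'" "subsp D" "\<And>\<alpha>. rs E \<alpha> \<in> D' \<longleftrightarrow> rs E \<alpha> \<in> D"
  shows "cdepth D E d"
  using assms by (intro cdepth_pullback[of D' E d D id]) auto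

lemma separates_Kplus_unitv:
  assumes "separates D E1 E2" "subsp D" "e \<in> E1" shows "separates (Kplus D (unitv e)) E1 E2"
  unfolding separates_def
proof (intro conjI allI impI)
  show "E1 \<inter> E2 = {}" using assms by (auto simp: separates_def)
  fix \<alpha> assume "rs (E1 \<union> E2) \<alpha> \<in> Kplus D (unitv e)"
  then obtain c where "rs (E1 \<union> E2) (\<lambda>j. \<alpha> j - c * unitv e j) \<in> D"
    using assms(3) by (auto simp: mem_Kplus rs_linear)
  then have "rs E1 (\<lambda>j. \<alpha> j - c * unitv e j) \<in> D" using assms(1) by (auto simp: separates_def)
  then show "rs E1 \<alpha> \<in> Kplus D (unitv e)"
    using assms(3) by (auto simp: mem_Kplus rs_linear)
qed

text \<open>If \<open>rs E2 \<alpha>\<close> minus a multiple of \<open>unitv e\<close> is a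
  dependency, it splits along the separation, and its part on \<open>E2\<close> is
  \<open>rs E2 \<alpha>\<close> itself.\<close>

lemma separates_Kplus_unitv_iff:
  assumes "separates D E1 E2" "subsp D" "e \<in> E1"
  shows "rs E2 \<alpha> \<in> Kplus D (unitv e) \<longleftrightarrow> rs E2 \<alpha> \<in> D"
proof
  assume "rs E2 \<alpha> \<in> Kplus D (unitv e)"
  then obtain c where c: "(\<lambda>j. rs E2 \<alpha> j - c * unitv e j) \<in> D" by (auto simp: mem_Kplus)
  have dis: "E1 \<inter> E2 = {}" using assms by (auto simp: separates_def)
  have "rs (E2 \<union> E1) (\<lambda>j. rs E2 \<alpha> j - c * unitv e j) = (\<lambda>j. rs E2 \<alpha> j - c * unitv e j)"
    using assms(3) by (auto simp: rs_def unitv_def)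
  with c have "rs E2 (\<lambda>j. rs E2 \<alpha> j - c * unitv e j) \<in> D"
    using separates_commute[OF assms(2,1)] by (simp add: separates_def)
  moreover have "rs E2 (\<lambda>j. rs E2 \<alpha> j - c * unitv e j) = rs E2 \<alpha>"
    using dis assms(3) by (auto simp: rs_def unitv_def fun_eq_iff)
  ultimately show "rs E2 \<alpha> \<in> D" by simp
qed (use Kplus_superset in blast)

text \<open>Contracting an arbitrary vector can increase the depth, since it may join separated
  parts; contracting an element only affects the part containing it.\<close>

lemma cdepth_Kplus_unitv:
  assumes "cdepth D E d" "subsp D" "e \<in> E" shows "cdepth (Kplus D (unitv e)) E d"
  using assms
proof (induction rule: cdepth.induct)
  case (leaf E D d)
  then show ?case using Kplus_superset by (intro cdepth.leaf) blast
next
  case (split D E1 E2 d)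
  have *: "cdepth (Kplus D (unitv e)) (F1 \<union> F2) d"
    if s: "separates D F1 F2" and e: "e \<in> F1" and F1: "cdepth (Kplus D (unitv e)) F1 d"
      and F2: "cdepth D F2 d" for F1 F2
  proof (rule cdepth.split[OF separates_Kplus_unitv[OF s split.prems(1) e] F1])
    show "cdepth (Kplus D (unitv e)) F2 d"
      using separates_Kplus_unitv_iff[OF s split.prems(1) e] split.prems(1)
      by (intro cdepth_cong[OF F2]) (auto intro: subsp_Kplus)
  qed
  show ?case
  proof (cases "e \<in> E1")
    case True
    then show ?thesis using *[of E1 E2] split by blast
  next
    case False
    then show ?thesis
      using *[of E2 E1] split separates_commute[of D E1 E2] by (simp add: Un_commute)
  qed
next
  case (contract D v E d)
  then show ?case
    by (metis Kplus_commute cdepth.contract subsp_Kplus)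
qed

subsection \<open>Circuits\<close>

definition supp :: "(nat \<Rightarrow> rat) \<Rightarrow> nat set" where
  "supp \<alpha> = {j. \<alpha> j \<noteq> 0}"

definition dep :: "(nat \<Rightarrow> rat) set \<Rightarrow> nat set \<Rightarrow> bool" where
  "dep D X \<longleftrightarrow> (\<exists>\<alpha>\<in>D. supp \<alpha> \<noteq> {} \<and> supp \<alpha> \<subseteq> X)"

definition circuit :: "(nat \<Rightarrow> rat) set \<Rightarrow> nat set \<Rightarrow> bool" where
  "circuit D C \<longleftrightarrow> dep D C \<and> (\<forall>Y. Y \<subset> C \<longrightarrow> \<not> dep D Y)"

lemma supp_rs: "supp (rs E \<alpha>) = E \<inter> supp \<alpha>"
  by (auto simp: supp_def rs_def)

lemma rs_id: "supp \<alpha> \<subseteq> E \<Longrightarrow> rs E \<alpha> = \<alpha>"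
  by (auto simp: supp_def rs_def fun_eq_iff)

lemma circuitE:
  assumes "circuit D C"
  obtains \<alpha> where "\<alpha> \<in> D" "supp \<alpha> = C" "C \<noteq> {}"
proof -
  from assms obtain \<alpha> where a: "\<alpha> \<in> D" "supp \<alpha> \<noteq> {}" "supp \<alpha> \<subseteq> C"
    by (auto simp: circuit_def dep_def)
  moreover have "dep D (supp \<alpha>)" using a by (auto simp: dep_def)
  ultimately have "supp \<alpha> = C" using assms by (auto simp: circuit_def)
  with a that show ?thesis by blast
qed

lemma circuit_eqI: "circuit D C \<Longrightarrow> dep D Y \<Longrightarrow> Y \<subseteq> C \<Longrightarrow> Y = C"
  by (auto simp: circuit_def)

text \<open>A vector of \<open>D\<close> outside \<open>B\<close> with smallest support works: if a
  vector of \<open>D\<close> had its nonempty support strictly inside, subtracting a multiple that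
  cancels one coordinate would write \<open>\<gamma>\<close> as a combination of two vectors of
  smaller support, both in \<open>B\<close> by minimality. Different choices of \<open>B\<close>
  give circuits through a given element, crossing a separation, or violating a restriction
  property.\<close>

lemma circuit_vector_outside:
  assumes "subsp D" "subsp B" "\<alpha> \<in> D" "\<alpha> \<notin> B" "finite (supp \<alpha>)"
  obtains \<gamma> where "\<gamma> \<in> D" "\<gamma> \<notin> B" "supp \<gamma> \<subseteq> supp \<alpha>" "circuit D (supp \<gamma>)"
proof -
  let ?P = "\<lambda>\<gamma>. \<gamma> \<in> D \<and> \<gamma> \<notin> B \<and> supp \<gamma> \<subseteq> supp \<alpha>"
  have "?P \<alpha>" using assms by auto
  from ex_has_least_nat[of ?P, OF this, of "\<lambda>\<gamma>. card (supp \<gamma>)"]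
  obtain \<gamma> where g: "?P \<gamma>" and min: "\<And>\<delta>. ?P \<delta> \<Longrightarrow> card (supp \<gamma>) \<le> card (supp \<delta>)" by blast
  have fin: "finite (supp \<gamma>)" using g assms(5) finite_subset by blast
  have small: "\<delta> \<in> B" if "\<delta> \<in> D" "supp \<delta> \<subset> supp \<gamma>" for \<delta>
    using min[of \<delta>] psubset_card_mono[OF fin that(2)] that g by force
  have "\<not> dep D Y" if Y: "Y \<subset> supp \<gamma>" for Y
  proof
    assume "dep D Y"
    then obtain \<delta> y where d: "\<delta> \<in> D" "supp \<delta> \<subseteq> Y" "\<delta> y \<noteq> 0" by (auto simp: dep_def supp_def)
    define c where "c = \<gamma> y / \<delta> y"
    define \<epsilon> where "\<epsilon> = (\<lambda>j. \<gamma> j - c * \<delta> j)"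
    have "\<epsilon> \<in> D" unfolding \<epsilon>_def using assms(1) g d by (intro subsp_diff_scale) auto
    moreover have "supp \<epsilon> \<subseteq> supp \<gamma>" using d Y by (auto simp: \<epsilon>_def supp_def)
    moreover have "y \<notin> supp \<epsilon>" "y \<in> supp \<gamma>" using d Y by (auto simp: \<epsilon>_def c_def supp_def)
    ultimately have "\<epsilon> \<in> B" using small[of \<epsilon>] by blast
    moreover have "\<delta> \<in> B" using small[of \<delta>] d Y by blast
    ultimately have "(\<lambda>j. \<epsilon> j + c * \<delta> j) \<in> B" by (rule subsp_add_scale[OF assms(2)])
    then show False using g by (simp add: \<epsilon>_def)
  qed
  moreover have "\<gamma> \<noteq> (\<lambda>_. 0)" using g subsp_zero[OF assms(2)] by auto
  then have "dep D (supp \<gamma>)" using g unfolding dep_def by (auto simp: supp_def fun_eq_iff)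
  ultimately have "circuit D (supp \<gamma>)" by (auto simp: circuit_def)
  then show ?thesis using that g by blast
qed

lemma circuit_through:
  assumes "subsp D" "\<alpha> \<in> D" "finite (supp \<alpha>)" "\<alpha> e \<noteq> 0"
  obtains C where "circuit D C" "e \<in> C" "C \<subseteq> supp \<alpha>"
proof -
  have "subsp {\<gamma>. \<gamma> e = 0}" by (simp add: subsp_def)
  from circuit_vector_outside[OF assms(1) this assms(2) _ assms(3)] assms(4)
  obtain \<gamma> where "\<gamma> e \<noteq> 0" "supp \<gamma> \<subseteq> supp \<alpha>" "circuit D (supp \<gamma>)" by auto
  then show ?thesis using that[of "supp \<gamma>"] by (auto simp: supp_def)
qed

text \<open>A circuit lies on one side of a separation, and one contraction at most halves its size:
  a circuit of \<open>D\<close> is covered by at most two circuits of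
  \<open>Kplus D v\<close>.\<close>

lemma circuit_card_le:
  assumes "cdepth D E d" "subsp D" "finite E" "circuit D C" "C \<subseteq> E"
  shows "card C \<le> 2 ^ d"
  using assms
proof (induction arbitrary: C rule: cdepth.induct)
  case (leaf E D d)
  then obtain e where e: "e \<in> C" using circuitE by blast
  have "dep D {e}" unfolding dep_def
    using leaf e by (intro bexI[of _ "unitv e"]) (auto simp: supp_def unitv_def)
  then have "{e} = C" using circuit_eqI[OF leaf.prems(3)] e by blast
  then have "card C = 1" by auto
  then show ?case by simp
next
  case (split D E1 E2 d)
  obtain \<alpha> where a: "\<alpha> \<in> D" "supp \<alpha> = C" "C \<noteq> {}" using split.prems(3) circuitE by blast
  have "rs E1 \<alpha> \<in> D"
    using split.hyps(1) a split.prems(4) rs_id[of \<alpha> "E1 \<union> E2"] by (auto simp: separates_def)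
  show ?case
  proof (cases "E1 \<inter> C = {}")
    case True
    then have "C \<subseteq> E2" using split.prems(4) by blast
    then show ?thesis using split by simp
  next
    case False
    then have "dep D (E1 \<inter> C)" unfolding dep_def
      using \<open>rs E1 \<alpha> \<in> D\<close> a by (intro bexI[of _ "rs E1 \<alpha>"]) (auto simp: supp_rs)
    then have "E1 \<inter> C = C" using circuit_eqI[OF split.prems(3)] by blast
    then have "C \<subseteq> E1" by blast
    then show ?thesis using split by simp
  qed
next
  case (contract D v E d)
  obtain \<alpha> where a: "\<alpha> \<in> D" "supp \<alpha> = C" "C \<noteq> {}" using contract.prems(3) circuitE by blast
  note sub = subsp_Kplus[OF contract.prems(1), of v]
  have fin: "finite C" using contract.prems finite_subset by blast
  have thru: "\<exists>Z. circuit (Kplus D v) Z \<and> e \<in> Z \<and> Z \<subseteq> C" if "e \<in> C" for e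
  proof -
    have "\<alpha> \<in> Kplus D v" using a Kplus_superset by blast
    from circuit_through[OF sub this, of e] show ?thesis
      using a that fin by (auto simp: supp_def)
  qed
  have bound: "card Z \<le> 2 ^ d" if "circuit (Kplus D v) Z" "Z \<subseteq> C" for Z
    using contract.IH[OF sub contract.prems(2) that(1)] that(2) contract.prems(4) by blast
  obtain Z1 where Z1: "circuit (Kplus D v) Z1" "Z1 \<subseteq> C" using thru a by blast
  show ?case
  proof (cases "Z1 = C")
    case True
    then show ?thesis using bound[OF Z1] by simp
  next
    case False
    then obtain f where f: "f \<in> C" "f \<notin> Z1" using Z1 by blast
    then obtain Z2 where Z2: "circuit (Kplus D v) Z2" "f \<in> Z2" "Z2 \<subseteq> C" using thru by blast
    obtain \<gamma>1 where g1: "\<gamma>1 \<in> Kplus D v" "supp \<gamma>1 = Z1" "Z1 \<noteq> {}" using Z1 circuitE by blast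
    obtain \<gamma>2 where g2: "\<gamma>2 \<in> Kplus D v" "supp \<gamma>2 = Z2" using Z2 circuitE by blast
    \<comment> \<open>Hence \<open>\<gamma>1\<close> can stand for \<open>v\<close>, and a multiple
      of it moves \<open>\<gamma>2\<close> into \<open>D\<close>. The difference is nonzero at
      \<open>f\<close>, so its support is a dependent subset of \<open>C\<close> and
      \<open>Z1 \<union> Z2\<close> exhausts \<open>C\<close>.\<close>
    have "\<gamma>1 \<notin> D"
    proof
      assume "\<gamma>1 \<in> D"
      then have "dep D Z1" using g1 by (auto simp: dep_def)
      then show False using circuit_eqI[OF contract.prems(3)] Z1 False by blast
    qed
    then have "Kplus D v = Kplus D \<gamma>1"
      using Kplus_exchange[OF contract.prems(1) g1(1)] by simp
    then obtain c where c: "(\<lambda>j. \<gamma>2 j - c * \<gamma>1 j) \<in> D" using g2 by (auto simp: mem_Kplus)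
    have "f \<in> supp (\<lambda>j. \<gamma>2 j - c * \<gamma>1 j)"
      using f Z2 g1 g2 by (auto simp: supp_def)
    moreover have "supp (\<lambda>j. \<gamma>2 j - c * \<gamma>1 j) \<subseteq> Z1 \<union> Z2"
      using g1 g2 by (auto simp: supp_def)
    ultimately have "dep D (Z1 \<union> Z2)" using c by (auto simp: dep_def)
    then have "Z1 \<union> Z2 = C" using circuit_eqI[OF contract.prems(3)] Z1 Z2 by blast
    then have "card C \<le> card Z1 + card Z2" using card_Un_le by blast
    also have "\<dots> \<le> 2 ^ d + 2 ^ d" using bound[OF Z1] bound[OF Z2(1,3)] by (rule add_mono)
    finally show ?thesis by simp
  qed
qed

subsection \<open>Contracting elements instead of vectors\<close>

text \<open>\<open>D'\<close> is \<open>D\<close> enlarged by \<open>j\<close> arbitrary vectors,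
  possibly redundant ones, so \<open>D'\<close> has dimension at most \<open>j\<close> over
  \<open>D\<close>.\<close>

fun extends :: "nat \<Rightarrow> (nat \<Rightarrow> rat) set \<Rightarrow> (nat \<Rightarrow> rat) set \<Rightarrow> bool" where
  "extends 0 D D' \<longleftrightarrow> D' = D"
| "extends (Suc j) D D' \<longleftrightarrow> (\<exists>v. extends j (Kplus D v) D')"

lemma extends_snoc: "extends j D D' \<Longrightarrow> extends (Suc j) D (Kplus D' v)"
proof (induction j arbitrary: D)
  case (Suc j)
  then show ?case by (metis extends.simps(2))
qed auto

lemma extends_subsp: "extends j D D' \<Longrightarrow> subsp D \<Longrightarrow> subsp D'"
  by (induction j arbitrary: D) (auto intro: subsp_Kplus)

lemma extends_Kplus: "extends j D D' \<Longrightarrow> extends j (Kplus D w) (Kplus D' w)"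
proof (induction j arbitrary: D)
  case (Suc j)
  then show ?case using Kplus_commute[of D w] by (metis extends.simps(2))
qed auto

text \<open>Steinitz exchange for several vectors: if \<open>w\<close> already arises from the first
  generator, it replaces that one; otherwise it is still new after adding the first generator and
  replaces a later one.\<close>

lemma extends_exchange:
  assumes "extends (Suc j) D D'" "subsp D" "w \<in> D'" "w \<notin> D" shows "extends j (Kplus D w) D'"
  using assms
proof (induction j arbitrary: D)
  case 0
  then show ?case using Kplus_exchange by auto
next
  case (Suc j)
  then obtain v where v: "extends (Suc j) (Kplus D v) D'" by auto
  show ?case
  proof (cases "w \<in> Kplus D v")
    case True
    then show ?thesis using Kplus_exchange Suc.prems v by metis
  next
    case False
    then have "extends j (Kplus (Kplus D v) w) D'"
      using Suc.IH[OF v] Suc.prems subsp_Kplus by blast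
    then have "extends j (Kplus (Kplus D w) v) D'" by (simp only: Kplus_commute)
    then show ?thesis by auto
  qed
qed

lemma cdepth_extends: "extends j D D' \<Longrightarrow> cdepth D' E d \<Longrightarrow> cdepth D E (d + j)"
  by (induction j arbitrary: D) (auto intro: cdepth.contract)

fun add_units :: "(nat \<Rightarrow> rat) set \<Rightarrow> nat list \<Rightarrow> (nat \<Rightarrow> rat) set" where
  "add_units D [] = D"
| "add_units D (e # es) = add_units (Kplus D (unitv e)) es"

lemma subsp_add_units: "subsp D \<Longrightarrow> subsp (add_units D es)"
  by (induction es arbitrary: D) (auto intro: subsp_Kplus)

lemma add_units_superset: "D \<subseteq> add_units D es"
proof (induction es arbitrary: D)
  case (Cons e es)
  then show ?case using Kplus_superset[of D "unitv e"] by (metis add_units.simps(2) subset_trans)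
qed auto

lemma unitv_in_add_units: "subsp D \<Longrightarrow> e \<in> set es \<Longrightarrow> unitv e \<in> add_units D es"
proof (induction es arbitrary: D)
  case (Cons a es)
  have "Kplus D (unitv a) \<subseteq> add_units (Kplus D (unitv a)) es" by (rule add_units_superset)
  then show ?case using Cons Kplus_self subsp_Kplus by (metis add_units.simps(2) set_ConsD subsetD)
qed auto

lemma add_units_Kplus: "add_units (Kplus D w) es = Kplus (add_units D es) w"
proof (induction es arbitrary: D)
  case (Cons e es)
  then show ?case by (simp add: Kplus_commute[of D w])
qed auto

lemma extends_add_units: "extends j D D' \<Longrightarrow> extends j (add_units D es) (add_units D' es)"
  by (induction es arbitrary: D D') (auto intro: extends_Kplus)

lemma cdepth_add_units:
  "cdepth D E d \<Longrightarrow> subsp D \<Longrightarrow> set es \<subseteq> E \<Longrightarrow> cdepth (add_units D es) E d"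
  by (induction es arbitrary: D) (auto intro: cdepth_Kplus_unitv subsp_Kplus)

definition inseparable :: "(nat \<Rightarrow> rat) set \<Rightarrow> nat set \<Rightarrow> bool" where
  "inseparable D E \<longleftrightarrow> (\<forall>E1 E2. E = E1 \<union> E2 \<longrightarrow> separates D E1 E2 \<longrightarrow> E1 = {} \<or> E2 = {})"

text \<open>Splits of an inseparable set are trivial and a leaf is excluded, so up to trivial splits
  the decomposition starts with a contraction.\<close>

lemma inseparable_cdepth:
  assumes "cdepth D E d" "inseparable D E" "\<not> (\<forall>e\<in>E. unitv e \<in> D)"
  obtains d' v where "d = Suc d'" "cdepth (Kplus D v) E d'"
proof -
  have "\<exists>d' v. d = Suc d' \<and> cdepth (Kplus D v) E d'" using assms
  proof (induction rule: cdepth.induct)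
    case (split D E1 E2 d)
    then have "E1 = {} \<or> E2 = {}" by (auto simp: inseparable_def)
    then show ?case using split by (metis Un_empty_left Un_empty_right)
  qed auto
  then show ?thesis using that by blast
qed

text \<open>Elements of \<open>E\<close> replace a contracted vector: if \<open>E\<close> is inseparable over \<open>D\<close> but
  separates into \<open>E1\<close> and \<open>E2\<close> over the extension \<open>D'\<close>, then contracting the part in \<open>E1\<close>
  of a circuit over \<open>D\<close> that meets both sides makes one of the generators of \<open>D'\<close> redundant.\<close>

lemma contract_elements_extends:
  assumes "cdepth D' E d" "extends (Suc j) D D'" "subsp D" "finite E" "inseparable D E"
    "\<And>C. circuit D C \<Longrightarrow> C \<subseteq> E \<Longrightarrow> card C \<le> c" "1 \<le> c"
  shows "\<exists>S. set S \<subseteq> E \<and> length S \<le> c \<and> cdepth (add_units D S) E (d + j)"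
  using assms
proof (induction arbitrary: j rule: cdepth.induct)
  case (leaf E D' d)
  show ?case
  proof (cases "\<forall>e\<in>E. unitv e \<in> D")
    case True
    then show ?thesis by (intro exI[of _ "[]"]) (auto intro: cdepth.leaf)
  next
    case False
    then obtain e where e: "e \<in> E" "unitv e \<notin> D" by blast
    \<comment> \<open>Over \<open>D'\<close> all elements are loops, so \<open>unitv e\<close> lies
      in \<open>D'\<close> but not in \<open>D\<close> and takes the place of one of the
      \<open>Suc j\<close> generators.\<close>
    then have "extends j (Kplus D (unitv e)) D'" using extends_exchange leaf by blast
    moreover have "cdepth D' E d" using leaf.hyps by (rule cdepth.leaf)
    ultimately have "cdepth (Kplus D (unitv e)) E (d + j)" by (rule cdepth_extends)
    then show ?thesis using e leaf.prems by (intro exI[of _ "[e]"]) auto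
  qed
next
  case (split D' E1 E2 d)
  show ?case
  proof (cases "E1 = {} \<or> E2 = {}")
    case True
    then show ?thesis
    proof
      assume "E1 = {}" then show ?thesis using split.IH(2)[OF split.prems(1)] split.prems by simp
    next
      assume "E2 = {}" then show ?thesis using split.IH(1)[OF split.prems(1)] split.prems by simp
    qed
  next
    case False
    then have "\<not> separates D E1 E2" using split.prems(4) by (auto simp: inseparable_def)
    moreover have dis: "E1 \<inter> E2 = {}" using split.hyps(1) by (auto simp: separates_def)
    ultimately obtain \<alpha>0 where a0: "rs (E1 \<union> E2) \<alpha>0 \<in> D" "rs E1 \<alpha>0 \<notin> D"
      by (auto simp: separates_def)
    have sub': "subsp D'" using extends_subsp split.prems by blast
    have DD': "D \<subseteq> D'"
    proof -
      have "extends i X Y \<Longrightarrow> X \<subseteq> Y" for i X Y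
        by (induction i arbitrary: X) (use Kplus_superset in fastforce)+
      then show ?thesis using split.prems by blast
    qed
    have "subsp {\<alpha>. rs E1 \<alpha> \<in> D}" using split.prems(2) by (rule subsp_rs_preimage)
    moreover have "rs E1 (rs (E1 \<union> E2) \<alpha>0) = rs E1 \<alpha>0" by (simp add: Int_absorb2)
    moreover have fin0: "finite (supp (rs (E1 \<union> E2) \<alpha>0))"
      using split.prems(3) by (simp add: supp_rs)
    \<comment> \<open>This circuit crosses the separation: its part in \<open>E1\<close> is not a
      dependency over \<open>D\<close>, so it is neither empty nor the whole circuit.\<close>
    ultimately obtain \<alpha> where a: "\<alpha> \<in> D" "\<alpha> \<notin> {\<alpha>. rs E1 \<alpha> \<in> D}"
        "supp \<alpha> \<subseteq> supp (rs (E1 \<union> E2) \<alpha>0)" and circ: "circuit D (supp \<alpha>)"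
      using circuit_vector_outside[of D "{\<alpha>. rs E1 \<alpha> \<in> D}" "rs (E1 \<union> E2) \<alpha>0"] a0 split.prems(2)
      by (metis mem_Collect_eq)
    then have a: "\<alpha> \<in> D" "rs E1 \<alpha> \<notin> D" "supp \<alpha> \<subseteq> E1 \<union> E2"
      by (auto simp: supp_rs)
    have fin: "finite (supp \<alpha>)" using a split.prems(3) finite_subset by blast
    have cardc: "card (supp \<alpha>) \<le> c" using split.prems(5) a circ by blast
    have "rs E1 \<alpha> \<in> D'"
      using split.hyps(1) a DD' rs_id[of \<alpha> "E1 \<union> E2"] by (auto simp: separates_def)
    \<comment> \<open>Over \<open>D'\<close> the sides do separate, so the part in \<open>E1\<close>
      lies in \<open>D'\<close> and may be taken as one of its generators.\<close>
    then have ext: "extends j (Kplus D (rs E1 \<alpha>)) D'"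
      using extends_exchange split.prems a by blast
    define S where "S = sorted_list_of_set (E1 \<inter> supp \<alpha>)"
    have S: "set S = E1 \<inter> supp \<alpha>" "length S = card (E1 \<inter> supp \<alpha>)"
      using fin by (auto simp: S_def)
    \<comment> \<open>Contracting the elements of \<open>S\<close> already generates
      \<open>rs E1 \<alpha>\<close>, so only \<open>j\<close> vectors remain to be added.\<close>
    have "rs E1 \<alpha> = rs (set S) \<alpha>" by (auto simp: S(1) rs_def supp_def)
    also have "\<dots> \<in> add_units D S"
      using split.prems(2)
      by (intro rs_in_of_units subsp_add_units) (auto intro: unitv_in_add_units)
    finally have "Kplus (add_units D S) (rs E1 \<alpha>) = add_units D S"
      using Kplus_absorb subsp_add_units split.prems(2) by blast
    then have "extends j (add_units D S) (add_units D' S)"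
      using extends_add_units[OF ext, of S] by (simp add: add_units_Kplus)
    moreover have "cdepth (add_units D' S) (E1 \<union> E2) d"
      using split.hyps S sub' by (intro cdepth_add_units cdepth.split) auto
    ultimately have "cdepth (add_units D S) (E1 \<union> E2) (d + j)" by (rule cdepth_extends)
    moreover have "length S \<le> c" 
      using cardc card_mono[OF fin, of "E1 \<inter> supp \<alpha>"] S(2) by auto
    ultimately show ?thesis using S(1) by blast
  qed
next
  case (contract D' v E d)
  \<comment> \<open>The vector \<open>v\<close> joins the extension: \<open>j\<close> grows by one
    while the remaining depth drops by one, so the sum \<open>d + j\<close> is preserved.\<close>
  then show ?case using extends_snoc[of "Suc j" D D' v] by fastforce
qed

text \<open>Contracting elements only has the effect that, for a column matroid, the contracted
  vectors are columns of the matrix and their entries obey the complexity bound.\<close>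

inductive edepth :: "(nat \<Rightarrow> rat) set \<Rightarrow> nat set \<Rightarrow> nat \<Rightarrow> bool" where
  leaf: "\<forall>e\<in>E. unitv e \<in> D \<Longrightarrow> edepth D E d"
| split: "separates D E1 E2 \<Longrightarrow> edepth D E1 d \<Longrightarrow> edepth D E2 d \<Longrightarrow> edepth D (E1 \<union> E2) d"
| contract: "e \<in> E \<Longrightarrow> edepth (Kplus D (unitv e)) E d \<Longrightarrow> edepth D E (Suc d)"

lemma edepth_mono: "edepth D E d \<Longrightarrow> d \<le> d' \<Longrightarrow> edepth D E d'"
proof (induction d')
  case (Suc d')
  have "edepth D E d \<Longrightarrow> edepth D E (Suc d)" for D E d
    by (induction rule: edepth.induct) (auto intro: edepth.intros)
  then show ?case using Suc by (auto simp: le_Suc_eq)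
qed auto

lemma edepth_add_units:
  "edepth (add_units D es) E d \<Longrightarrow> set es \<subseteq> E \<Longrightarrow> edepth D E (d + length es)"
  by (induction es arbitrary: D) (auto intro: edepth.contract)

text \<open>One vector contracted at depth \<open>Suc d\<close> is traded for at most
  \<open>2 ^ Suc d\<close> elements, the bound on circuit sizes at that depth.\<close>

primrec elim_bound :: "nat \<Rightarrow> nat" where
  "elim_bound 0 = 0"
| "elim_bound (Suc d) = elim_bound d + 2 ^ Suc d"

text \<open>Induction on \<open>(d, card E)\<close> in lexicographic order: a separation keeps the
  depth and shrinks the set, while a contraction lowers the depth.\<close>

lemma edepth_if_cdepth:
  assumes "cdepth D E d" "subsp D" "finite E"
  shows "edepth D E (elim_bound d)"
  using assms
proof (induction "(d, card E)" arbitrary: d D E rule: wf_induct_rule[OF wf_lex_prod[OF wf_less_than wf_less_than]])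
  case (1 d E D)
  consider "\<forall>e\<in>E. unitv e \<in> D" | "\<not> inseparable D E"
    | "inseparable D E" "\<not> (\<forall>e\<in>E. unitv e \<in> D)" by blast
  then show ?case
  proof cases
    case 1
    then show ?thesis by (rule edepth.leaf)
  next
    case 2
    then obtain E1 E2 where E: "E = E1 \<union> E2" "separates D E1 E2" "E1 \<noteq> {}" "E2 \<noteq> {}"
      by (auto simp: inseparable_def)
    then have "E1 \<subset> E" "E2 \<subset> E" by (auto simp: separates_def)
    then have "card E1 < card E" "card E2 < card E" "finite E1" "finite E2"
      using 1(4) psubset_card_mono finite_subset by blast+
    then have "edepth D E1 (elim_bound d)" "edepth D E2 (elim_bound d)"
      using 1(1)[of d E1 D] 1(1)[of d E2 D] cdepth_subset[OF 1(2)] 1(3) E(1) by auto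
    then show ?thesis unfolding E(1) using E(2) by (rule edepth.split[rotated])
  next
    case 3
    then obtain d' v where d: "d = Suc d'" "cdepth (Kplus D v) E d'"
      using inseparable_cdepth 1(2) by blast
    \<comment> \<open>Here \<open>Kplus D v\<close> extends \<open>D\<close> by a single vector, so
      \<open>j = 0\<close>: after contracting \<open>S\<close>, depth \<open>d'\<close> is reached
      without \<open>v\<close>.\<close>
    have "\<exists>S. set S \<subseteq> E \<and> length S \<le> 2 ^ Suc d' \<and> cdepth (add_units D S) E (d' + 0)"
      using 1(2-4) d 3 by (intro contract_elements_extends[of "Kplus D v"])
        (auto dest: circuit_card_le)
    then obtain S where S: "set S \<subseteq> E" "length S \<le> 2 ^ Suc d'" "cdepth (add_units D S) E d'" by auto
    then have "edepth (add_units D S) E (elim_bound d')"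
      using 1(1)[of d' E "add_units D S"] d subsp_add_units[OF 1(3)] 1(4) by auto
    then have "edepth D E (elim_bound d' + length S)" using S by (intro edepth_add_units) auto
    then show ?thesis using S d by (auto elim!: edepth_mono)
  qed
qed

subsection \<open>Connected components\<close>

lemma circuit_not_psubset: "circuit D C1 \<Longrightarrow> circuit D C2 \<Longrightarrow> \<not> C1 \<subset> C2"
  by (auto simp: circuit_def)

text \<open>Strong circuit elimination: a multiple of the vector of \<open>C2\<close> cancels
  \<open>x\<close>, and the entry at \<open>e\<close> survives because \<open>e\<close> is outside
  \<open>C2\<close>.\<close>

lemma circuit_elimination:
  assumes "subsp D" "circuit D C1" "circuit D C2" "finite C1" "finite C2"
    "x \<in> C1" "x \<in> C2" "e \<in> C1" "e \<notin> C2"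
  obtains C where "circuit D C" "e \<in> C" "C \<subseteq> C1 \<union> C2 - {x}"
proof -
  obtain \<alpha> where a: "\<alpha> \<in> D" "supp \<alpha> = C1" using assms(2) circuitE by blast
  obtain \<beta> where b: "\<beta> \<in> D" "supp \<beta> = C2" using assms(3) circuitE by blast
  define \<gamma> where "\<gamma> = (\<lambda>j. \<alpha> j - (\<alpha> x / \<beta> x) * \<beta> j)"
  have "\<gamma> \<in> D" unfolding \<gamma>_def by (rule subsp_diff_scale[OF assms(1) a(1) b(1)])
  have supp: "supp \<gamma> \<subseteq> C1 \<union> C2 - {x}" using a(2) b(2) assms(7) by (auto simp: \<gamma>_def supp_def)
  then have "finite (supp \<gamma>)" using assms(4,5) finite_subset by blast
  moreover have "\<gamma> e \<noteq> 0"
    using a(2) b(2) assms(8,9) by (auto simp: \<gamma>_def supp_def)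
  ultimately show ?thesis
    using circuit_through[OF assms(1) \<open>\<gamma> \<in> D\<close>] supp that by (metis subset_trans)
qed

text \<open>Transitivity of lying in a common circuit, by induction on the size of
  \<open>C1 \<union> C2\<close>. Eliminating a shared element \<open>x\<close> while keeping
  \<open>e\<close> gives \<open>C3\<close>; eliminating \<open>y \<in> C3 \<inter> C2 - C1\<close>
  while keeping \<open>g\<close> gives \<open>C4\<close>.\<close>

lemma circuit_trans:
  assumes "subsp D" "circuit D C1" "circuit D C2" "finite (C1 \<union> C2)"
    "C1 \<inter> C2 \<noteq> {}" "e \<in> C1" "g \<in> C2"
  shows "\<exists>C. circuit D C \<and> e \<in> C \<and> g \<in> C \<and> C \<subseteq> C1 \<union> C2"
  using assms
proof (induction "card (C1 \<union> C2)" arbitrary: C1 C2 rule: less_induct)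
  case less
  have IH: "\<exists>C. circuit D C \<and> e \<in> C \<and> g \<in> C \<and> C \<subseteq> C1 \<union> C2"
    if "circuit D Z1" "circuit D Z2" "Z1 \<inter> Z2 \<noteq> {}" "e \<in> Z1" "g \<in> Z2" "Z1 \<union> Z2 \<subset> C1 \<union> C2" for Z1 Z2
  proof -
    have "card (Z1 \<union> Z2) < card (C1 \<union> C2)" using that less.prems by (intro psubset_card_mono) auto
    moreover have "finite (Z1 \<union> Z2)" using that less.prems finite_subset by blast
    ultimately show ?thesis using less.hyps[of Z1 Z2] that less.prems(1) by blast
  qed
  have fin: "finite C1" "finite C2" using less.prems by auto
  show ?case
  proof (cases "e \<in> C2 \<or> g \<in> C1")
    case True
    then show ?thesis using less.prems by blast
  next
    case False
    obtain x where x: "x \<in> C1" "x \<in> C2" using less.prems by blast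
    obtain C3 where C3: "circuit D C3" "e \<in> C3" "C3 \<subseteq> C1 \<union> C2 - {x}"
      using circuit_elimination[of D C1 C2 x e] less.prems fin x False by blast
    then obtain y where y: "y \<in> C3" "y \<in> C2" "y \<notin> C1"
      using circuit_not_psubset[OF C3(1) less.prems(2)] x by blast
    show ?thesis
    proof (cases "g \<in> C3 \<or> C3 \<union> C2 \<subset> C1 \<union> C2")
      case True
      then show ?thesis using IH[of C3 C2] C3 y less.prems by blast
    next
      case False
      have "finite C3" using C3 less.prems finite_subset by blast
      then obtain C4 where C4: "circuit D C4" "g \<in> C4" "C4 \<subseteq> C2 \<union> C3 - {y}"
        using circuit_elimination[of D C2 C3 y g] less.prems fin C3 y False by blast
      then obtain z where "z \<in> C4" "z \<in> C3" "z \<notin> C2"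
        using circuit_not_psubset[OF C4(1) less.prems(3)] y by blast
      \<comment> \<open>As \<open>z\<close> lies in \<open>C3\<close> but not in \<open>C2\<close>,
        it lies in \<open>C1\<close>, so \<open>C1\<close> and \<open>C4\<close> meet. Both miss
        \<open>y\<close>, so their union is strictly smaller.\<close>
      then show ?thesis using IH[of C1 C4] C3 C4 y less.prems by blast
    qed
  qed
qed

definition related :: "(nat \<Rightarrow> rat) set \<Rightarrow> nat set \<Rightarrow> nat \<Rightarrow> nat \<Rightarrow> bool" where
  "related D E e f \<longleftrightarrow> e = f \<or> (\<exists>C. circuit D C \<and> C \<subseteq> E \<and> e \<in> C \<and> f \<in> C)"

lemma related_sym: "related D E e f \<Longrightarrow> related D E f e"
  by (auto simp: related_def)

lemma related_trans:
  assumes "subsp D" "finite E" "related D E e f" "related D E f g" shows "related D E e g"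
proof (cases "e = f \<or> f = g")
  case True
  then show ?thesis using assms by auto
next
  case False
  then obtain C1 C2 where C: "circuit D C1" "C1 \<subseteq> E" "e \<in> C1" "f \<in> C1"
    "circuit D C2" "C2 \<subseteq> E" "f \<in> C2" "g \<in> C2"
    using assms by (auto simp: related_def)
  then have "finite (C1 \<union> C2)" using assms(2) finite_subset by blast
  then show ?thesis using circuit_trans[of D C1 C2 e g] assms(1) C unfolding related_def by blast
qed

definition star :: "(nat \<Rightarrow> rat) set \<Rightarrow> nat set \<Rightarrow> nat \<Rightarrow> nat set" where
  "star D E e = {f \<in> E. related D E e f}"

text \<open>A circuit within \<open>E\<close> lies entirely inside or entirely outside the class of
  \<open>e\<close>, so no circuit vector can violate the claim.\<close>

lemma rs_star:
  assumes "subsp D" "finite E" "rs E \<alpha> \<in> D" shows "rs (star D E e) \<alpha> \<in> D"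
proof (rule ccontr)
  let ?C = "star D E e"
  assume n: "rs ?C \<alpha> \<notin> D"
  have "?C \<inter> E = ?C" by (auto simp: star_def)
  then have "rs E \<alpha> \<notin> {\<gamma>. rs ?C \<gamma> \<in> D}" using n by simp
  moreover have "finite (supp (rs E \<alpha>))" using assms(2) by (simp add: supp_rs)
  ultimately obtain \<gamma> where g: "\<gamma> \<in> D" "\<gamma> \<notin> {\<gamma>. rs ?C \<gamma> \<in> D}" "supp \<gamma> \<subseteq> supp (rs E \<alpha>)"
      "circuit D (supp \<gamma>)"
    using circuit_vector_outside[OF assms(1) subsp_rs_preimage[OF assms(1)] assms(3)] by metis
  have sub: "supp \<gamma> \<subseteq> E" using g(3) by (auto simp: supp_rs)
  show False
  proof (cases "supp \<gamma> \<inter> ?C = {}")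
    case True
    then have "rs ?C \<gamma> = (\<lambda>_. 0)" by (auto simp: rs_def supp_def fun_eq_iff)
    then show False using g subsp_zero[OF assms(1)] by simp
  next
    case False
    then obtain f where f: "f \<in> supp \<gamma>" "related D E e f" by (auto simp: star_def)
    have "related D E f h" if "h \<in> supp \<gamma>" for h
      using that f g(4) sub unfolding related_def by blast
    then have "supp \<gamma> \<subseteq> ?C"
      using f(2) sub related_trans[OF assms(1,2)] by (auto simp: star_def)
    then show False using g by (simp add: rs_id)
  qed
qed

lemma star_eq_or_disjoint:
  assumes "subsp D" "finite E"
  shows "star D E e = star D E f \<or> star D E e \<inter> star D E f = {}"
proof (cases "related D E e f")
  case True
  then have "related D E e g \<longleftrightarrow> related D E f g" for g
    using related_trans[OF assms] related_sym by metis
  then show ?thesis by (simp add: star_def)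
next
  case False
  have "\<not> (related D E e g \<and> related D E f g)" for g
    using related_trans[OF assms, of e g f] related_sym[of D E f g] False by blast
  then show ?thesis by (auto simp: star_def)
qed

text \<open>The classes are split off one at a time; by \<open>rs_star\<close> each one is separated
  from the union of the others.\<close>

lemma cdepth_Union_stars:
  assumes "subsp D" "finite E" "finite F" "F \<subseteq> star D E ` E" "\<forall>C\<in>F. cdepth D C d"
  shows "cdepth D (\<Union>F) d"
  using assms(3,4,5)
proof (induction F rule: finite_induct)
  case empty
  then show ?case by (auto intro: cdepth.leaf)
next
  case (insert C F)
  obtain e where C: "C = star D E e" using insert.prems by blast
  have disj: "C \<inter> \<Union>F = {}"
  proof -
    have "C \<inter> C' = {}" if C': "C' \<in> F" for C'
    proof -
      obtain f where "C' = star D E f" using C' insert.prems by blast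
      moreover have "C \<noteq> C'" using C' insert.hyps by auto
      ultimately show ?thesis using star_eq_or_disjoint[OF assms(1,2), of e f] C by simp
    qed
    then show ?thesis by blast
  qed
  have sub: "C \<union> \<Union>F \<subseteq> E" using insert.prems by (auto simp: star_def)
  have "separates D C (\<Union>F)" unfolding separates_def
  proof (intro conjI allI impI disj)
    fix \<alpha> assume "rs (C \<union> \<Union>F) \<alpha> \<in> D"
    then have "rs E (rs (C \<union> \<Union>F) \<alpha>) \<in> D" using sub by (simp add: Int_absorb1)
    from rs_star[OF assms(1,2) this, of e] C show "rs C \<alpha> \<in> D"
      by (simp add: Int_absorb2)
  qed
  then show ?case using insert by (auto intro: cdepth.split)
qed

subsection \<open>Column matroids\<close>

definition lc :: "nat \<Rightarrow> (nat \<Rightarrow> nat \<Rightarrow> rat) \<Rightarrow> nat \<Rightarrow> (nat \<Rightarrow> rat) \<Rightarrow> nat \<Rightarrow> rat" where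
  "lc m A n \<alpha> = (\<lambda>i. \<Sum>j<n. \<alpha> j * col m A j i)"

text \<open>Preimage of \<open>K\<close> under the column map. Coefficients at indices from
  \<open>n\<close> on are unconstrained, so element sets are always taken below
  \<open>n\<close>.\<close>

definition deps :: "nat \<Rightarrow> (nat \<Rightarrow> nat \<Rightarrow> rat) \<Rightarrow> nat \<Rightarrow> (nat \<Rightarrow> rat) set \<Rightarrow> (nat \<Rightarrow> rat) set" where
  "deps m A n K = {\<alpha>. lc m A n \<alpha> \<in> K}"

lemma lc_add_scale: "lc m A n (\<lambda>j. \<alpha> j + c * \<beta> j) = (\<lambda>i. lc m A n \<alpha> i + c * lc m A n \<beta> i)"
  by (simp add: lc_def sum.distrib sum_distrib_left distrib_right mult.assoc)

lemma lc_diff_scale: "lc m A n (\<lambda>j. \<alpha> j - c * \<beta> j) = (\<lambda>i. lc m A n \<alpha> i - c * lc m A n \<beta> i)"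
  using lc_add_scale[of m A n \<alpha> "- c" \<beta>] by simp

lemma lc_rs: "X \<subseteq> {..<n} \<Longrightarrow> lc m A n (rs X \<alpha>) = (\<lambda>i. \<Sum>j\<in>X. \<alpha> j * col m A j i)"
  unfolding lc_def by (intro ext sum.mono_neutral_cong_right) (auto simp: rs_def)

lemma lc_beyond: "i \<ge> m \<Longrightarrow> lc m A n \<alpha> i = 0"
  by (simp add: lc_def col_def)

lemma subsp_deps: "subsp K \<Longrightarrow> subsp (deps m A n K)"
proof -
  assume K: "subsp K"
  have "lc m A n (\<lambda>_. 0) = (\<lambda>_. 0)" by (simp add: lc_def)
  then show ?thesis
    using subsp_zero[OF K] subsp_add_scale[OF K]
    unfolding subsp_def by (simp add: deps_def lc_add_scale)
qed

lemma deps_Kplus: "deps m A n (Kplus K (lc m A n w)) = Kplus (deps m A n K) w"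
  by (auto simp: deps_def mem_Kplus lc_diff_scale)

text \<open>If a combination of columns lies in \<open>Kplus K v\<close> but not in
  \<open>K\<close>, it replaces \<open>v\<close> by exchange and its coefficients give
  \<open>w\<close>. Otherwise no dependency is added and \<open>w\<close> can be zero.\<close>

lemma deps_Kplus_ex:
  assumes "subsp K" obtains w where "deps m A n (Kplus K v) = Kplus (deps m A n K) w"
proof (cases "\<exists>\<gamma>. lc m A n \<gamma> \<in> Kplus K v \<and> lc m A n \<gamma> \<notin> K")
  case True
  then obtain \<gamma> where "lc m A n \<gamma> \<in> Kplus K v" "lc m A n \<gamma> \<notin> K" by blast
  then show ?thesis using Kplus_exchange[OF assms] deps_Kplus that by metis
next
  case False
  then have "deps m A n (Kplus K v) = deps m A n K"
    using Kplus_superset by (auto simp: deps_def)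
  then show ?thesis
    using that[of "\<lambda>_. 0"] Kplus_absorb subsp_deps subsp_zero assms by metis
qed

lemma mdep_iff:
  assumes "X \<subseteq> {..<n}" shows "mdep m A K X \<longleftrightarrow> dep (deps m A n K) X"
proof
  assume "mdep m A K X"
  then obtain \<alpha> j where "j \<in> X" "\<alpha> j \<noteq> 0" "rs X \<alpha> \<in> deps m A n K"
    by (auto simp: mdep_def deps_def lc_rs[OF assms])
  then show "dep (deps m A n K) X"
    unfolding dep_def supp_rs by (intro bexI[of _ "rs X \<alpha>"]) (auto simp: supp_rs, auto simp: supp_def)
next
  assume "dep (deps m A n K) X"
  then obtain \<alpha> where "\<alpha> \<in> deps m A n K" "supp \<alpha> \<noteq> {}" "supp \<alpha> \<subseteq> X" by (auto simp: dep_def)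
  then show "mdep m A K X"
    using lc_rs[OF assms, of m A \<alpha>] rs_id[of \<alpha> X]
    unfolding mdep_def deps_def by (intro exI[of _ \<alpha>]) (auto simp: supp_def)
qed

lemma mcircuit_iff:
  assumes "E \<subseteq> {..<n}" shows "mcircuit m A K E C \<longleftrightarrow> C \<subseteq> E \<and> circuit (deps m A n K) C"
proof (cases "C \<subseteq> E")
  case True
  then have "mdep m A K Y \<longleftrightarrow> dep (deps m A n K) Y" if "Y \<subseteq> C" for Y
    using that assms by (intro mdep_iff) auto
  then show ?thesis unfolding mcircuit_def circuit_def by auto
qed (simp add: mcircuit_def)

lemma mrank_eq_0_iff:
  assumes "E \<subseteq> {..<n}" "subsp K"
  shows "mrank m A K E = 0 \<longleftrightarrow> (\<forall>e\<in>E. unitv e \<in> deps m A n K)"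
proof -
  let ?D = "deps m A n K" and ?I = "{X. X \<subseteq> E \<and> \<not> mdep m A K X}"
  have fin: "finite E" using assms finite_subset by blast
  then have finI: "finite (card ` ?I)" by simp
  have "{} \<in> ?I" by (simp add: mdep_def)
  have "mrank m A K E = Max (card ` ?I)" unfolding mrank_def by (rule arg_cong[of _ _ Max]) auto
  also have "\<dots> = 0 \<longleftrightarrow> (\<forall>X\<in>?I. card X = 0)"
  proof -
    have "card ` ?I \<noteq> {}" using \<open>{} \<in> ?I\<close> by blast
    from Max_le_iff[OF finI this, of 0] show ?thesis by simp
  qed
  also have "\<dots> \<longleftrightarrow> (\<forall>X. X \<subseteq> E \<longrightarrow> X \<noteq> {} \<longrightarrow> dep ?D X)"
  proof -
    have "mdep m A K X \<longleftrightarrow> dep ?D X" "card X = 0 \<longleftrightarrow> X = {}" if "X \<subseteq> E" for X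
      using that assms(1) mdep_iff[of X n] finite_subset[OF that fin] by auto
    then show ?thesis by blast
  qed
  also have "\<dots> \<longleftrightarrow> (\<forall>e\<in>E. unitv e \<in> ?D)"
  proof (intro iffI ballI allI impI)
    fix e assume "e \<in> E" "\<forall>X. X \<subseteq> E \<longrightarrow> X \<noteq> {} \<longrightarrow> dep ?D X"
    then have "dep ?D {e}" by blast
    then obtain \<alpha> where a: "\<alpha> \<in> ?D" "supp \<alpha> = {e}" by (auto simp: dep_def)
    then have "unitv e = (\<lambda>j. (1 / \<alpha> e) * \<alpha> j)" by (auto simp: unitv_def supp_def fun_eq_iff)
    also have "\<dots> \<in> ?D" by (rule subsp_scale[OF subsp_deps[OF assms(2)] a(1)])
    finally show "unitv e \<in> ?D" .
  next
    fix X assume "\<forall>e\<in>E. unitv e \<in> ?D" "X \<subseteq> E" "X \<noteq> {}"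
    then obtain e where "e \<in> X" "unitv e \<in> ?D" by blast
    then show "dep ?D X" unfolding dep_def
      by (intro bexI[of _ "unitv e"]) (auto simp: supp_def unitv_def)
  qed
  finally show ?thesis .
qed

lemma mconnected_iff:
  assumes "E \<subseteq> {..<n}"
  shows "mconnected m A K E \<longleftrightarrow> (\<forall>e\<in>E. \<forall>f\<in>E. related (deps m A n K) E e f)"
proof -
  have "related (deps m A n K) E e f \<longleftrightarrow>
      (e \<noteq> f \<longrightarrow> (\<exists>C. mcircuit m A K E C \<and> e \<in> C \<and> f \<in> C))" for e f
    unfolding related_def mcircuit_iff[OF assms] by auto
  then show ?thesis unfolding mconnected_def by auto
qed

lemma mcomponents_eq:
  assumes "E \<subseteq> {..<n}" shows "mcomponents m A K E = star (deps m A n K) E ` E"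
proof -
  have "{f \<in> E. e = f \<or> (\<exists>C. mcircuit m A K E C \<and> e \<in> C \<and> f \<in> C)} = star (deps m A n K) E e" for e
    unfolding star_def related_def mcircuit_iff[OF assms] by meson
  then show ?thesis unfolding mcomponents_def by (simp add: Setcompr_eq_image)
qed

section \<open>Agreement of \<open>csd_le\<close> with the relaxed depth\<close>

lemma cdepth_if_csd_le:
  assumes "csd_le m A K E d" "subsp K" "E \<subseteq> {..<n}" shows "cdepth (deps m A n K) E d"
  using assms
proof (induction rule: csd_le.induct)
  case (rank0 K E d)
  then show ?case using mrank_eq_0_iff[of E n K m A] by (intro cdepth.leaf) simp
next
  case (disconn K E d)
  let ?D = "deps m A n K"
  have fin: "finite E" using disconn.prems finite_subset by blast
  have "cdepth ?D C d" if "C \<in> star ?D E ` E" for C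
    using disconn.IH that disconn.prems by (auto simp: mcomponents_eq star_def)
  then have "cdepth ?D (\<Union>(star ?D E ` E)) d"
    using disconn.prems fin by (intro cdepth_Union_stars[of _ E] subsp_deps) auto
  moreover have "\<Union>(star ?D E ` E) = E" by (auto simp: star_def related_def)
  ultimately show ?case by simp
next
  case (conn K E v d)
  obtain w where "deps m A n (Kplus K v) = Kplus (deps m A n K) w"
    using deps_Kplus_ex conn.prems by blast
  then show ?case using conn subsp_Kplus by (auto intro: cdepth.contract)
qed

text \<open>\<open>csd_le\<close> prescribes the rule to apply, so the decomposition is rearranged:
  a connected set must start with a contraction, and a disconnected one is restricted to its
  components at the same depth. This is why the connected case is shown first, for all subsets at
  depth \<open>d\<close>.\<close>

lemma csd_le_if_cdepth:
  assumes "cdepth (deps m A n K) E d" "subsp K" "E \<subseteq> {..<n}" shows "csd_le m A K E d"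
  using assms
proof (induction d arbitrary: K E rule: less_induct)
  case (less d)
  let ?D = "deps m A n K"
  have connected: "csd_le m A K F d"
    if F: "cdepth ?D F d" "F \<subseteq> {..<n}" "mconnected m A K F" for F
  proof (cases "mrank m A K F = 0")
    case True
    then show ?thesis by (rule csd_le.rank0)
  next
    case False
    \<comment> \<open>A circuit through elements of both sides would have its part in
      \<open>F1\<close> as a smaller dependent set.\<close>
    have "inseparable ?D F" unfolding inseparable_def
    proof (intro allI impI, rule ccontr)
      fix F1 F2 assume F12: "F = F1 \<union> F2" "separates ?D F1 F2" "\<not> (F1 = {} \<or> F2 = {})"
      then obtain e f where ef: "e \<in> F1" "f \<in> F2" by blast
      then have "e \<noteq> f" using F12 by (auto simp: separates_def)
      then obtain C where C: "circuit ?D C" "C \<subseteq> F" "e \<in> C" "f \<in> C"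
        using F(3) ef F12(1) unfolding mconnected_iff[OF F(2)] related_def by blast
      then obtain \<alpha> where a: "\<alpha> \<in> ?D" "supp \<alpha> = C" using circuitE by blast
      then have "rs F1 \<alpha> \<in> ?D"
        using F12 C rs_id[of \<alpha> F] by (auto simp: separates_def)
      then have "dep ?D (F1 \<inter> C)"
        unfolding dep_def using a C ef by (intro bexI[of _ "rs F1 \<alpha>"]) (auto simp: supp_rs)
      then have "F1 \<inter> C = C" using circuit_eqI[OF C(1)] by blast
      then show False using C ef F12 by (auto simp: separates_def)
    qed
    moreover have "\<not> (\<forall>e\<in>F. unitv e \<in> ?D)"
      using False mrank_eq_0_iff[OF F(2) less.prems(2), of m A] by simp
    ultimately obtain d' v where d': "d = Suc d'" "cdepth (Kplus ?D v) F d'"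
      using inseparable_cdepth F(1) by blast
    then have "cdepth (deps m A n (Kplus K (lc m A n v))) F d'" by (simp add: deps_Kplus)
    then have "csd_le m A (Kplus K (lc m A n v)) F d'"
      using less.IH d'(1) subsp_Kplus less.prems(2) F(2) by blast
    then show ?thesis
      using csd_le.conn[of m A K F "lc m A n v" d'] False F(3) d'(1) lc_beyond by simp
  qed
  consider "mrank m A K E = 0" | "mconnected m A K E" | "mrank m A K E > 0" "\<not> mconnected m A K E"
    by blast
  then show ?case
  proof cases
    case 1
    then show ?thesis by (rule csd_le.rank0)
  next
    case 2
    then show ?thesis using connected less.prems by blast
  next
    case 3
    have fin: "finite E" using less.prems finite_subset by blast
    have "csd_le m A K C d" if C: "C \<in> mcomponents m A K E" for C
    proof -
      obtain e where e: "e \<in> E" "C = star ?D E e"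
        using C mcomponents_eq[OF less.prems(3), of m A K] by auto
      have sub: "C \<subseteq> E" using e by (auto simp: star_def)
      \<comment> \<open>A component is connected on its own: every circuit within \<open>E\<close>
        that meets it stays inside it.\<close>
      have "related ?D C f g" if fg: "f \<in> C" "g \<in> C" for f g
      proof -
        have "related ?D E e f" "related ?D E e g" using fg e by (auto simp: star_def)
        then have "related ?D E f g"
          using related_sym related_trans[OF subsp_deps[OF less.prems(2)] fin] by blast
        then consider "f = g" | Z where "circuit ?D Z" "Z \<subseteq> E" "f \<in> Z" "g \<in> Z"
          by (auto simp: related_def)
        then show ?thesis
        proof cases
          case (2 Z)
          have "h \<in> C" if h: "h \<in> Z" for h
          proof -
            have "related ?D E f h" using 2 h by (auto simp: related_def)
            then have "related ?D E e h"
              using \<open>related ?D E e f\<close> related_trans[OF subsp_deps[OF less.prems(2)] fin] by blast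
            then show ?thesis using e 2 h by (auto simp: star_def)
          qed
          then show ?thesis using 2 unfolding related_def by blast
        qed (simp add: related_def)
      qed
      then have "mconnected m A K C" using mconnected_iff[of C n m A K] sub less.prems(3) by simp
      moreover have "cdepth ?D C d" using cdepth_subset less.prems(1) sub by blast
      ultimately show ?thesis using connected sub less.prems(3) by blast
    qed
    then show ?thesis using 3 by (intro csd_le.disconn) auto
  qed
qed

lemma subsp_singleton_0: "subsp {\<lambda>i. 0}"
  by (simp add: subsp_def)

text \<open>Contracting the elements one by one turns all of them into loops. This ensures that the
  \<open>LEAST\<close> in \<open>csd\<close> is attained.\<close>

lemma cdepth_card:
  assumes "finite E" "subsp D" shows "cdepth D E (card E)"
proof -
  have "cdepth D E (card F)" if "finite F"
      "subsp D" "\<forall>e\<in>E - F. unitv e \<in> D" for F D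
    using that
  proof (induction F arbitrary: D rule: finite_induct)
    case empty
    then show ?case by (auto intro: cdepth.leaf)
  next
    case (insert f F)
    have "cdepth (Kplus D (unitv f)) E (card F)"
    proof (rule insert.IH)
      show "subsp (Kplus D (unitv f))" by (rule subsp_Kplus[OF insert.prems(1)])
      show "\<forall>e\<in>E - F. unitv e \<in> Kplus D (unitv f)"
        using insert.prems Kplus_self Kplus_superset by blast
    qed
    then show ?case using insert.hyps by (auto intro: cdepth.contract)
  qed
  from this[of E D] assms show ?thesis by auto
qed

lemma csd_le_iff_cdepth:
  "E \<subseteq> {..<n} \<Longrightarrow> csd_le m A {\<lambda>i. 0} E d \<longleftrightarrow> cdepth (deps m A n {\<lambda>i. 0}) E d"
  using cdepth_if_csd_le[OF _ subsp_singleton_0] csd_le_if_cdepth[OF _ subsp_singleton_0] by metis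

lemma csd_le_csd: "finite E \<Longrightarrow> csd_le m A {\<lambda>i. 0} E (csd m A E)"
proof -
  assume "finite E"
  then obtain n where n: "E \<subseteq> {..<n}" using finite_nat_iff_bounded by blast
  have "csd_le m A {\<lambda>i. 0} E (card E)"
    unfolding csd_le_iff_cdepth[OF n]
    by (intro cdepth_card \<open>finite E\<close> subsp_deps subsp_singleton_0)
  then show ?thesis unfolding csd_def by (rule LeastI)
qed

lemma csd_leI: "csd_le m A {\<lambda>i. 0} E d \<Longrightarrow> csd m A E \<le> d"
  unfolding csd_def by (rule Least_le)

subsection \<open>Almost-full relations\<close>

definition almost_full_on :: "('a \<Rightarrow> 'a \<Rightarrow> bool) \<Rightarrow> 'a set \<Rightarrow> bool" where
  "almost_full_on P A \<longleftrightarrow> (\<forall>f :: nat \<Rightarrow> 'a. (\<forall>i. f i \<in> A) \<longrightarrow> (\<exists>i j. i < j \<and> P (f i) (f j)))"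

lemma almost_full_onD:
  assumes "almost_full_on P A" "\<And>i :: nat. f i \<in> A"
  obtains i j where "i < j" "P (f i) (f j)"
proof -
  have "\<exists>i j. i < j \<and> P (f i) (f j)"
    using assms(1)[unfolded almost_full_on_def, rule_format, of f] assms(2) by blast
  then show ?thesis using that by blast
qed

text \<open>Ramsey's theorem for pairs coloured by whether \<open>P\<close> holds from the earlier
  to the later index: a homogeneous set on which \<open>P\<close> always fails would contradict
  almost-fullness.\<close>

lemma almost_full_on_subsequence:
  assumes "almost_full_on P A" "\<And>i :: nat. f i \<in> A"
  obtains \<phi> :: "nat \<Rightarrow> nat" where "strict_mono \<phi>" "\<And>i j. i < j \<Longrightarrow> P (f (\<phi> i)) (f (\<phi> j))"
proof -
  \<comment> \<open>\<open>Min\<close> and \<open>Max\<close> recover the order of an unordered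
    pair.\<close>
  define c where "c X = (if P (f (Min X)) (f (Max X)) then 0 else 1 :: nat)" for X
  have c: "c {x, y} = (if P (f x) (f y) then 0 else 1)" if "x < y" for x y
    using that by (auto simp: c_def)
  have "\<forall>x\<in>UNIV. \<forall>y\<in>UNIV. x \<noteq> y \<longrightarrow> c {x, y} < 2" by (simp add: c_def)
  from Ramsey2[OF infinite_UNIV_nat this]
  obtain Y t where Y: "infinite Y" "\<And>x y. x \<in> Y \<Longrightarrow> y \<in> Y \<Longrightarrow> x \<noteq> y \<Longrightarrow> c {x, y} = t"
    by metis
  let ?\<phi> = "enumerate Y"
  have mono: "strict_mono ?\<phi>" by (rule strict_mono_enumerate[OF Y(1)])
  have t: "c {?\<phi> i, ?\<phi> j} = t" if "i < j" for i j
    using Y(2)[of "?\<phi> i" "?\<phi> j"] enumerate_in_set[OF Y(1)] strict_monoD[OF mono that] by auto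
  obtain i j where "i < j" "P (f (?\<phi> i)) (f (?\<phi> j))"
    using almost_full_onD[OF assms(1), of "\<lambda>i. f (?\<phi> i)"] assms(2) by blast
  then have "t = 0" using t[of i j] c[of "?\<phi> i" "?\<phi> j"] strict_monoD[OF mono] by auto
  then have "P (f (?\<phi> i)) (f (?\<phi> j))" if "i < j" for i j
    using t[OF that] c[of "?\<phi> i" "?\<phi> j"] strict_monoD[OF mono that] by (auto split: if_splits)
  then show ?thesis using that mono by blast
qed

text \<open>Higman's lemma, by the minimal bad sequence argument of Nash-Williams. Ramsey's theorem
  replaces transitivity of \<open>P\<close>.\<close>

theorem almost_full_on_lists:
  assumes "almost_full_on P A" shows "almost_full_on (list_emb P) (lists A)"
proof (rule ccontr)
  define bad where "bad f \<longleftrightarrow> (\<forall>i. f i \<in> lists A) \<and> (\<forall>i j. i < j \<longrightarrow> \<not> list_emb P (f i) (f j))"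
    for f :: "nat \<Rightarrow> 'a list"
  define agree where "agree n f g \<longleftrightarrow> (\<forall>i<n. g i = f i)" for n and f g :: "nat \<Rightarrow> 'a list"
  define least where "least n f \<longleftrightarrow> bad f \<and> (\<forall>g. bad g \<longrightarrow> agree n f g \<longrightarrow> length (f n) \<le> length (g n))"
    for n f
  assume "\<not> almost_full_on (list_emb P) (lists A)"
  then obtain f0 where f0: "bad f0" unfolding almost_full_on_def bad_def by blast
  have ex_least: "\<exists>g. agree n f g \<and> least n g" if f: "bad f" for n f
  proof -
    have "bad f \<and> agree n f f" using f by (simp add: agree_def)
    from ex_has_least_nat[of "\<lambda>g. bad g \<and> agree n f g", OF this, of "\<lambda>g. length (g n)"]
    obtain g where "bad g" "agree n f g"
      "\<And>h. bad h \<Longrightarrow> agree n f h \<Longrightarrow> length (g n) \<le> length (h n)" by blast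
    then show ?thesis by (auto simp: least_def agree_def)
  qed
  \<comment> \<open>Each \<open>F (Suc n)\<close> keeps the entries of \<open>F n\<close> up to
    index \<open>n\<close> and minimizes the length of the next one. The diagonal \<open>h\<close>
    is the minimal bad sequence.\<close>
  have "\<exists>F. \<forall>n. least n (F n) \<and> agree (Suc n) (F n) (F (Suc n))"
  proof (rule dependent_nat_choice)
    show "\<exists>f. least 0 f" using ex_least[OF f0] by blast
    fix f n assume "least n f"
    then show "\<exists>g. least (Suc n) g \<and> agree (Suc n) f g" using ex_least least_def by blast
  qed
  then obtain F where F: "\<And>n. least n (F n)" "\<And>n. agree (Suc n) (F n) (F (Suc n))" by blast
  define h where "h n = F n n" for n
  have Fh: "F n i = h i" if "i \<le> n" for n i
    using that
  proof (induction n)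
    case (Suc n)
    then show ?case using F(2)[of n] by (cases "i = Suc n") (auto simp: h_def agree_def)
  qed (simp add: h_def)
  have badF: "bad (F n)" for n using F(1) by (simp add: least_def)
  have bad_h: "bad h" unfolding bad_def
  proof (intro conjI allI impI)
    fix i show "h i \<in> lists A" using badF[of i] by (simp add: h_def bad_def)
    fix j assume "(i :: nat) < j"
    then show "\<not> list_emb P (h i) (h j)" using badF[of j] Fh[of i j] Fh[of j j] by (metis bad_def less_imp_le order_refl)
  qed
  have h_ne: "h i \<noteq> []" for i using bad_h by (metis bad_def lessI list_emb_Nil)
  have hA: "h i \<in> lists A" for i using bad_h by (simp add: bad_def)
  then have "hd (h i) \<in> A" for i using h_ne[of i] by (cases "h i") (auto dest: spec[of _ i])
  then obtain \<phi> :: "nat \<Rightarrow> nat" where \<phi>: "strict_mono \<phi>"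
      "\<And>i j. i < j \<Longrightarrow> P (hd (h (\<phi> i))) (hd (h (\<phi> j)))"
    using almost_full_on_subsequence[OF assms, of "\<lambda>i. hd (h i)"] by blast
  define n where "n = \<phi> 0"
  \<comment> \<open>From position \<open>n\<close> on, \<open>h\<close> is replaced by the tails of
    the lists whose heads form a \<open>P\<close>-chain. This is bad again but shorter at
    \<open>n\<close>, against the minimality of \<open>F n\<close>.\<close>
  define g where "g i = (if i < n then h i else tl (h (\<phi> (i - n))))" for i
  have emb_tl: "list_emb P xs (tl (h i)) \<Longrightarrow> list_emb P xs (h i)" for xs i
    using h_ne[of i] by (cases "h i") auto
  have "bad g" unfolding bad_def
  proof (intro conjI allI impI notI)
    fix i
    have "tl (h k) \<in> lists A" for k using hA[of k] by (cases "h k") auto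
    then show "g i \<in> lists A" using hA by (simp add: g_def)
    fix j assume ij: "i < j" "list_emb P (g i) (g j)"
    consider "j < n" | "i < n" "n \<le> j" | "n \<le> i" using ij by linarith
    then show False
    proof cases
      case 1
      then show False using ij bad_h by (simp add: g_def bad_def)
    next
      case 2
      \<comment> \<open>Here \<open>i < n = \<phi> 0 \<le> \<phi> (j - n)\<close>, so an embedding
        into a tail extends to a forbidden embedding within \<open>h\<close>.\<close>
      have "i < \<phi> (j - n)" using 2 strict_mono_mono[OF \<phi>(1)] monoD[of \<phi> 0 "j - n"] by (auto simp: n_def)
      moreover have "list_emb P (h i) (h (\<phi> (j - n)))" using 2 ij emb_tl by (simp add: g_def)
      ultimately show False using bad_h by (simp add: bad_def)
    next
      case 3
      define a b where "a = \<phi> (i - n)" and "b = \<phi> (j - n)"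
      have lt: "i - n < j - n" using 3 ij by linarith
      then have "a < b" using strict_monoD[OF \<phi>(1)] by (simp add: a_def b_def)
      moreover have "list_emb P (hd (h a) # tl (h a)) (hd (h b) # tl (h b))"
        using \<phi>(2)[OF lt] 3 ij by (intro list_emb_Cons2) (auto simp: g_def a_def b_def)
      ultimately show False using bad_h h_ne by (simp add: bad_def)
    qed
  qed
  moreover have "agree n (F n) g" using Fh by (simp add: agree_def g_def)
  ultimately have "length (F n n) \<le> length (g n)" using F(1)[of n] by (simp add: least_def)
  moreover have "g n = tl (h n)" by (simp add: g_def n_def)
  ultimately have "length (h n) \<le> length (tl (h n))" by (simp only: h_def)
  then show False using h_ne[of n] by (cases "h n") auto
qed

subsection \<open>Embeddings of configurations\<close>

definition lcs :: "(nat \<Rightarrow> nat \<Rightarrow> rat) \<Rightarrow> nat set \<Rightarrow> (nat \<Rightarrow> rat) \<Rightarrow> nat \<Rightarrow> rat" where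
  "lcs u E \<alpha> = (\<lambda>i. \<Sum>e\<in>E. \<alpha> e * u e i)"

text \<open>Coefficients are indexed by position, so that the same \<open>\<beta>\<close> can be
  applied to the bases of two configurations and a base may contain repetitions.\<close>

definition lcl :: "(nat \<Rightarrow> nat \<Rightarrow> rat) \<Rightarrow> nat list \<Rightarrow> (nat \<Rightarrow> rat) \<Rightarrow> nat \<Rightarrow> rat" where
  "lcl u L \<beta> = (\<lambda>i. \<Sum>t<length L. \<beta> t * u (L ! t) i)"

definition lspan :: "(nat \<Rightarrow> nat \<Rightarrow> rat) \<Rightarrow> nat list \<Rightarrow> (nat \<Rightarrow> rat) set" where
  "lspan u L = range (lcl u L)"

lemma lcl_add_scale: "lcl u L (\<lambda>t. \<beta> t + c * \<gamma> t) = (\<lambda>i. lcl u L \<beta> i + c * lcl u L \<gamma> i)"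
  by (simp add: lcl_def sum.distrib sum_distrib_left distrib_right mult.assoc)

lemma lcl_zero: "lcl u L (\<lambda>_. 0) = (\<lambda>_. 0)"
  by (simp add: lcl_def)

lemma lcl_Cons: "lcl u (a # L) \<beta> = (\<lambda>i. lcl u L (\<lambda>t. \<beta> (Suc t)) i + \<beta> 0 * u a i)"
  by (simp only: lcl_def list.size(4) sum.lessThan_Suc_shift add_0_right One_nat_def add_Suc_right)
    (simp add: add.commute)

lemma lspan_Nil: "lspan u [] = {\<lambda>_. 0}"
  by (auto simp: lspan_def lcl_def)

lemma lspan_Cons: "lspan u (a # L) = Kplus (lspan u L) (u a)"
proof
  show "lspan u (a # L) \<subseteq> Kplus (lspan u L) (u a)"
    by (auto simp: lspan_def lcl_Cons Kplus_def)
  show "Kplus (lspan u L) (u a) \<subseteq> lspan u (a # L)"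
  proof
    fix x assume "x \<in> Kplus (lspan u L) (u a)"
    then obtain \<beta> c where "x = (\<lambda>i. lcl u L \<beta> i + c * u a i)" by (auto simp: lspan_def Kplus_def)
    then have "x = lcl u (a # L) (case_nat c \<beta>)" by (simp add: lcl_Cons)
    then show "x \<in> lspan u (a # L)" by (auto simp: lspan_def)
  qed
qed

lemma subsp_lspan: "subsp (lspan u L)"
proof (induction L)
  case (Cons a L)
  then show ?case by (simp add: lspan_Cons subsp_Kplus)
qed (simp add: lspan_Nil subsp_def)

lemma lcs_union:
  "finite E \<Longrightarrow> finite F \<Longrightarrow> E \<inter> F = {} \<Longrightarrow> lcs u (E \<union> F) \<alpha> = (\<lambda>i. lcs u E \<alpha> i + lcs u F \<alpha> i)"
  by (simp add: lcs_def sum.union_disjoint)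

text \<open>The counterpart of \<open>separates\<close> over a base: modulo the span of
  \<open>L\<close>, the spans of \<open>E\<close> and \<open>F\<close> meet trivially.\<close>

definition direct :: "(nat \<Rightarrow> nat \<Rightarrow> rat) \<Rightarrow> nat list \<Rightarrow> nat set \<Rightarrow> nat set \<Rightarrow> bool" where
  "direct u L E F \<longleftrightarrow> E \<inter> F = {} \<and> (\<forall>\<alpha>. lcs u (E \<union> F) \<alpha> \<in> lspan u L \<longrightarrow> lcs u E \<alpha> \<in> lspan u L)"

text \<open>A configuration \<open>(u, L, E)\<close> consists of the vectors \<open>u e\<close> for \<open>e \<in> E\<close> over the base
  vectors \<open>u a\<close> for \<open>a\<close> in the list \<open>L\<close>. An embedding fixes the base and preserves and
  reflects linear dependencies.\<close>

type_synonym config = "(nat \<Rightarrow> nat \<Rightarrow> rat) \<times> nat list \<times> nat set"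

definition embeds_via ::
  "(nat \<Rightarrow> nat) \<Rightarrow> (nat \<Rightarrow> nat \<Rightarrow> rat) \<Rightarrow> nat list \<Rightarrow> nat set \<Rightarrow>
    (nat \<Rightarrow> nat \<Rightarrow> rat) \<Rightarrow> nat list \<Rightarrow> nat set \<Rightarrow> bool" where
  "embeds_via \<iota> u L E u' L' E' \<longleftrightarrow> inj_on \<iota> E \<and> \<iota> ` E \<subseteq> E' \<and>
     (\<forall>\<beta> \<alpha>. (\<forall>i. lcl u L \<beta> i + lcs u E \<alpha> i = 0) \<longleftrightarrow>
            (\<forall>i. lcl u' L' \<beta> i + lcs (\<lambda>e. u' (\<iota> e)) E \<alpha> i = 0))"

definition config_emb :: "config \<Rightarrow> config \<Rightarrow> bool" where
  "config_emb = (\<lambda>(u, L, E) (u', L', E'). \<exists>\<iota>. embeds_via \<iota> u L E u' L' E')"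

lemma embeds_via_base:
  assumes "embeds_via \<iota> u L E u' L' E'" shows "embeds_via \<kappa> u L {} u' L' F'"
proof -
  have "(\<forall>i. lcl u L \<beta> i = 0) \<longleftrightarrow> (\<forall>i. lcl u' L' \<beta> i = 0)" for \<beta>
  proof -
    have "lcs w E (\<lambda>_. 0) = (\<lambda>_. 0)" for w by (simp add: lcs_def)
    with assms show ?thesis unfolding embeds_via_def by (metis add.right_neutral)
  qed
  then show ?thesis by (simp add: embeds_via_def lcs_def)
qed

text \<open>The first base vector is forgotten by giving it the coefficient 0.\<close>

lemma embeds_via_tl:
  assumes "embeds_via \<iota> u (a # L) E u' (a' # L') E'" shows "embeds_via \<iota> u L E u' L' E'"
proof -
  have "(\<forall>i. lcl u L \<beta> i + lcs u E \<alpha> i = 0) \<longleftrightarrow>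
        (\<forall>i. lcl u' L' \<beta> i + lcs (\<lambda>e. u' (\<iota> e)) E \<alpha> i = 0)" for \<beta> \<alpha>
  proof -
    have "lcl w (b # M) (case_nat 0 \<beta>) = lcl w M \<beta>" for w b M by (simp add: lcl_Cons)
    with assms show ?thesis unfolding embeds_via_def by metis
  qed
  with assms show ?thesis by (simp add: embeds_via_def)
qed

text \<open>By directness a dependency on the union splits into one on each part, up to a base
  combination. The parts transfer separately, and they recombine because both embeddings fix the
  same base.\<close>

lemma embeds_via_union:
  assumes e1: "embeds_via \<iota>1 u L E1 u' L' F1" and e2: "embeds_via \<iota>2 u L E2 u' L' F2"
    and d: "direct u L E1 E2" and d': "direct u' L' F1 F2"
    and fin: "finite E1" "finite E2" "finite F1" "finite F2"
  shows "\<exists>\<iota>. embeds_via \<iota> u L (E1 \<union> E2) u' L' (F1 \<union> F2)"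
proof -
  define \<iota> where "\<iota> e = (if e \<in> E1 then \<iota>1 e else \<iota>2 e)" for e
  have disE: "E1 \<inter> E2 = {}" and disF: "F1 \<inter> F2 = {}" using d d' by (auto simp: direct_def)
  have im: "\<iota> ` E1 \<subseteq> F1" "\<iota> ` E2 \<subseteq> F2"
    using e1 e2 disE by (auto simp: embeds_via_def \<iota>_def)
  have inj1: "inj_on \<iota> E1" using e1 by (auto simp: embeds_via_def \<iota>_def inj_on_def)
  have inj2: "inj_on \<iota> E2" using e2 disE by (auto simp: embeds_via_def \<iota>_def inj_on_def)
  have inj: "inj_on \<iota> (E1 \<union> E2)" unfolding inj_on_Un using inj1 inj2 im disF by blast
  let ?u = "\<lambda>e. u' (\<iota> e)"
  have "lcs (\<lambda>e. u' (\<iota>1 e)) E1 = lcs ?u E1" "lcs (\<lambda>e. u' (\<iota>2 e)) E2 = lcs ?u E2"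
    using disE unfolding lcs_def \<iota>_def by (fastforce intro!: ext sum.cong)+
  then have t1: "(\<forall>i. lcl u L \<beta> i + lcs u E1 \<alpha> i = 0) \<longleftrightarrow> (\<forall>i. lcl u' L' \<beta> i + lcs ?u E1 \<alpha> i = 0)"
    and t2: "(\<forall>i. lcl u L \<beta> i + lcs u E2 \<alpha> i = 0) \<longleftrightarrow> (\<forall>i. lcl u' L' \<beta> i + lcs ?u E2 \<alpha> i = 0)"
    for \<beta> \<alpha>
    using e1 e2 by (simp_all add: embeds_via_def)
  have E_part: "lcs u E1 \<alpha> \<in> lspan u L" if "lcs u (E1 \<union> E2) \<alpha> \<in> lspan u L" for \<alpha>
    using d that by (simp add: direct_def)
  have F_part: "lcs ?u E1 \<alpha> \<in> lspan u' L'" if a: "lcs ?u (E1 \<union> E2) \<alpha> \<in> lspan u' L'" for \<alpha>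
  proof -
    \<comment> \<open>The coefficients are pushed forward along \<open>\<iota>\<close> and set to 0
      off its image, so that directness of \<open>F1\<close> and \<open>F2\<close> applies to
      them.\<close>
    define \<alpha>' where "\<alpha>' f = (if f \<in> \<iota> ` (E1 \<union> E2) then \<alpha> (inv_into (E1 \<union> E2) \<iota> f) else 0)" for f
    have re: "lcs u' F \<alpha>' = lcs ?u E \<alpha>"
      if E: "E \<subseteq> E1 \<union> E2" "\<iota> ` E \<subseteq> F" "F \<inter> \<iota> ` (E1 \<union> E2) = \<iota> ` E" "finite F" for E F
    proof (rule ext)
      fix i
      have "lcs u' F \<alpha>' i = (\<Sum>f\<in>\<iota> ` E. \<alpha>' f * u' f i)"
        unfolding lcs_def using E by (intro sum.mono_neutral_right) (auto simp: \<alpha>'_def)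
      also have "\<dots> = (\<Sum>e\<in>E. \<alpha>' (\<iota> e) * u' (\<iota> e) i)"
        using inj_on_subset[OF inj E(1)] by (simp add: sum.reindex)
      also have "\<dots> = lcs ?u E \<alpha> i"
        unfolding lcs_def using E(1) inj by (intro sum.cong) (auto simp: \<alpha>'_def subset_iff)
      finally show "lcs u' F \<alpha>' i = lcs ?u E \<alpha> i" .
    qed
    have "lcs u' (F1 \<union> F2) \<alpha>' = lcs ?u (E1 \<union> E2) \<alpha>" using im fin by (intro re) auto
    then have "lcs u' F1 \<alpha>' \<in> lspan u' L'" using d' a by (simp add: direct_def)
    moreover have "lcs u' F1 \<alpha>' = lcs ?u E1 \<alpha>" using im disF fin by (intro re) auto
    ultimately show ?thesis by simp
  qed
  \<comment> \<open>Stated for arbitrary source and target, so that it serves both directions of the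
    equivalence.\<close>
  have transfer: "\<forall>i. lcl y M' \<beta> i + lcs w' (E1 \<union> E2) \<alpha> i = 0"
    if eq: "\<forall>i. lcl x M \<beta> i + lcs w (E1 \<union> E2) \<alpha> i = 0"
      and part: "lcs w (E1 \<union> E2) \<alpha> \<in> lspan x M \<Longrightarrow> lcs w E1 \<alpha> \<in> lspan x M"
      and s1: "\<And>\<beta>. \<forall>i. lcl x M \<beta> i + lcs w E1 \<alpha> i = 0 \<Longrightarrow> \<forall>i. lcl y M' \<beta> i + lcs w' E1 \<alpha> i = 0"
      and s2: "\<And>\<beta>. \<forall>i. lcl x M \<beta> i + lcs w E2 \<alpha> i = 0 \<Longrightarrow> \<forall>i. lcl y M' \<beta> i + lcs w' E2 \<alpha> i = 0"
    for x y w w' :: "nat \<Rightarrow> nat \<Rightarrow> rat" and M M' \<alpha> \<beta>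
  proof -
    note un = lcs_union[OF fin(1,2) disE]
    have "lcs w (E1 \<union> E2) \<alpha> = (\<lambda>i. - 1 * lcl x M \<beta> i)" using eq by (auto simp: eq_neg_iff_add_eq_0 add.commute)
    also have "\<dots> \<in> lspan x M" by (rule subsp_scale[OF subsp_lspan]) (simp add: lspan_def)
    \<comment> \<open>The part on \<open>E1\<close> equals the base combination
      \<open>\<gamma>\<close>: the relation with \<open>- \<gamma>\<close> transfers on
      \<open>E1\<close>, the one with \<open>\<beta> + \<gamma>\<close> on \<open>E2\<close>, and
      \<open>\<gamma>\<close> cancels in the sum.\<close>
    finally obtain \<gamma> where g: "lcs w E1 \<alpha> = lcl x M \<gamma>" using part by (auto simp: lspan_def)
    have "\<forall>i. lcl x M (\<lambda>t. 0 + (- 1) * \<gamma> t) i + lcs w E1 \<alpha> i = 0"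
      unfolding lcl_add_scale g lcl_zero by simp
    from s1[OF this] have 1: "lcs w' E1 \<alpha> i = lcl y M' \<gamma> i" for i
      unfolding lcl_add_scale lcl_zero by simp
    have "\<forall>i. lcl x M (\<lambda>t. \<beta> t + 1 * \<gamma> t) i + lcs w E2 \<alpha> i = 0"
      using eq unfolding lcl_add_scale un g by (simp add: add.assoc)
    from s2[OF this] have "lcl y M' \<beta> i + lcl y M' \<gamma> i + lcs w' E2 \<alpha> i = 0" for i
      unfolding lcl_add_scale by simp
    then show ?thesis unfolding un 1 by (simp add: add.assoc)
  qed
  have "embeds_via \<iota> u L (E1 \<union> E2) u' L' (F1 \<union> F2)"
    unfolding embeds_via_def
  proof (intro conjI allI iffI)
    show "inj_on \<iota> (E1 \<union> E2)" by (rule inj)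
    show "\<iota> ` (E1 \<union> E2) \<subseteq> F1 \<union> F2" using im by blast
  next
    fix \<beta> \<alpha> i assume "\<forall>i. lcl u L \<beta> i + lcs u (E1 \<union> E2) \<alpha> i = 0"
    from transfer[OF this E_part, of u' L' ?u] t1 t2
    show "lcl u' L' \<beta> i + lcs ?u (E1 \<union> E2) \<alpha> i = 0" by blast
  next
    fix \<beta> \<alpha> i assume "\<forall>i. lcl u' L' \<beta> i + lcs ?u (E1 \<union> E2) \<alpha> i = 0"
    from transfer[OF this F_part, of u L u] t1 t2
    show "lcl u L \<beta> i + lcs u (E1 \<union> E2) \<alpha> i = 0" by blast
  qed
  then show ?thesis by blast
qed

fun direct_list :: "(nat \<Rightarrow> nat \<Rightarrow> rat) \<Rightarrow> nat list \<Rightarrow> nat set list \<Rightarrow> bool" where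
  "direct_list u L [] \<longleftrightarrow> True"
| "direct_list u L (E # Es) \<longleftrightarrow> direct u L E (\<Union>(set Es)) \<and> direct_list u L Es"

lemma config_emb_Union:
  assumes "list_emb (\<lambda>E F. config_emb (u, L, E) (u', L', F)) Es Fs"
    "direct_list u L Es" "direct_list u' L' Fs" "\<forall>E\<in>set Es. finite E" "\<forall>F\<in>set Fs. finite F"
    "embeds_via \<kappa> u L {} u' L' {}"
  shows "config_emb (u, L, \<Union>(set Es)) (u', L', \<Union>(set Fs))"
  using assms
proof (induction rule: list_emb.induct)
  case (list_emb_Nil Fs)
  then show ?case by (auto simp: config_emb_def intro: embeds_via_base)
next
  case (list_emb_Cons Es Fs F)
  then obtain \<iota> where "embeds_via \<iota> u L (\<Union>(set Es)) u' L' (\<Union>(set Fs))"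
    by (auto simp: config_emb_def)
  then have "embeds_via \<iota> u L (\<Union>(set Es)) u' L' (\<Union>(set (F # Fs)))"
    by (auto simp: embeds_via_def)
  then show ?case by (auto simp: config_emb_def)
next
  case (list_emb_Cons2 E F Es Fs)
  then obtain \<iota>1 \<iota>2 where "embeds_via \<iota>1 u L E u' L' F"
      "embeds_via \<iota>2 u L (\<Union>(set Es)) u' L' (\<Union>(set Fs))"
    by (auto simp: config_emb_def)
  from embeds_via_union[OF this] list_emb_Cons2.prems show ?case
    by (simp add: config_emb_def)
qed

text \<open>A decomposition in normal form: each layer is a direct sum of parts, each with a marked
  element that is added to the base below it. All leaves are at depth exactly \<open>N\<close>, so
  their bases have equal length. Lists of parts are nonempty so that an embedding of lists matches
  at least one part and thereby the bases.\<close>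

fun layered :: "nat \<Rightarrow> (nat \<Rightarrow> nat \<Rightarrow> rat) \<Rightarrow> nat list \<Rightarrow> nat set \<Rightarrow> bool" where
  "layered 0 u L E \<longleftrightarrow> (\<exists>e. E = {e})"
| "layered (Suc N) u L E \<longleftrightarrow> (\<exists>xs. xs \<noteq> [] \<and> E = \<Union>(set (map snd xs)) \<and>
     direct_list u L (map snd xs) \<and> (\<forall>(a, F)\<in>set xs. a \<in> F \<and> layered N u (a # L) F))"

lemma layered_finite: "layered N u L E \<Longrightarrow> finite E"
proof (induction N arbitrary: L E)
  case (Suc N)
  then obtain xs where xs: "E = \<Union>(set (map snd xs))"
      "\<forall>(a, F)\<in>set xs. a \<in> F \<and> layered N u (a # L) F"
    by auto
  have "finite (snd x)" if "x \<in> set xs" for x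
    using xs(2) that Suc.IH[of "fst x # L" "snd x"] by auto
  then show ?case unfolding xs(1) by simp
qed auto

lemma layered_parts_finite:
  assumes "\<forall>(a, F)\<in>set xs. a \<in> F \<and> layered N u (a # L) F"
  shows "\<forall>F\<in>set (map snd xs). finite F"
proof
  fix F assume "F \<in> set (map snd xs)"
  then obtain a where "(a, F) \<in> set xs" by auto
  with assms show "finite F" using layered_finite by blast
qed

text \<open>A linear relation holds iff it holds in every row, so order and multiplicity of rows are
  irrelevant and a set suffices.\<close>

definition rows :: "(nat \<Rightarrow> nat \<Rightarrow> rat) \<Rightarrow> nat list \<Rightarrow> rat list set" where
  "rows u L = range (\<lambda>i. map (\<lambda>j. u j i) L)"

lemma embeds_via_singleton:
  assumes "rows u (e # L) = rows u' (e' # L')" "length L = length L'"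
  shows "embeds_via (\<lambda>_. e') u L {e} u' L' {e'}"
proof -
  have *: "(\<forall>i. lcl w M \<beta> i + \<alpha> * w f i = 0) \<longleftrightarrow>
      (\<forall>r\<in>rows w (f # M). (\<Sum>t<length M. \<beta> t * r ! Suc t) + \<alpha> * r ! 0 = 0)" for w M f \<beta> \<alpha>
    by (simp add: rows_def lcl_def)
  show ?thesis unfolding embeds_via_def
  proof (intro conjI allI)
    fix \<beta> \<alpha>
    show "(\<forall>i. lcl u L \<beta> i + lcs u {e} \<alpha> i = 0) \<longleftrightarrow>
          (\<forall>i. lcl u' L' \<beta> i + lcs (\<lambda>_. u' e') {e} \<alpha> i = 0)"
      using *[of u L \<beta> "\<alpha> e" e] *[of u' L' \<beta> "\<alpha> e" e'] assms by (simp add: lcs_def)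
  qed auto
qed

text \<open>Induction on the number of layers, for all base lengths. Single elements are compared by
  pigeonhole on their row sets, which consist of words of length \<open>Suc p\<close> over
  \<open>Q\<close>. A layer is a list of configurations with a base one longer, to which Higman's
  lemma applies.\<close>

theorem almost_full_on_layered:
  assumes "finite Q"
  shows "almost_full_on config_emb
    {(u, L, E). layered N u L E \<and> length L = p \<and> (\<forall>j\<in>set L \<union> E. \<forall>i. u j i \<in> Q)}"
proof (induction N arbitrary: p)
  case 0
  show ?case unfolding almost_full_on_def
  proof (intro allI impI)
    fix X :: "nat \<Rightarrow> config"
    assume X: "\<forall>i. X i \<in> {(u, L, E). layered 0 u L E \<and> length L = p \<and> (\<forall>j\<in>set L \<union> E. \<forall>i. u j i \<in> Q)}"
    define u L E where "u = (\<lambda>i. fst (X i))" and "L = (\<lambda>i. fst (snd (X i)))" and "E = (\<lambda>i. snd (snd (X i)))"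
    have Xeq: "X i = (u i, L i, E i)" for i by (simp add: u_def L_def E_def)
    have X': "\<exists>e. E i = {e}" "length (L i) = p" "\<forall>j\<in>set (L i) \<union> E i. \<forall>r. u i j r \<in> Q" for i
      using X[rule_format, of i] unfolding Xeq by auto
    from X'(1) obtain e where e: "\<And>i. E i = {e i}" by metis
    define T where "T i = rows (u i) (e i # L i)" for i
    have "T i \<subseteq> {w. set w \<subseteq> Q \<and> length w = Suc p}" for i
      using X'(2,3)[of i] e[of i] by (auto simp: T_def rows_def)
    then have "range T \<subseteq> Pow {w. set w \<subseteq> Q \<and> length w = Suc p}" by blast
    then have "finite (range T)"
      by (rule finite_subset) (simp add: finite_lists_length_eq[OF assms])
    then have "\<not> inj T" using finite_imageD[of T UNIV] infinite_UNIV_nat by auto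
    then obtain i j where ij: "i \<noteq> j" "T i = T j" by (auto simp: inj_on_def)
    have "config_emb (X a) (X b)" if "T a = T b" for a b
      using embeds_via_singleton[of "u a" "e a" "L a" "u b" "e b" "L b"] that X'(2)
      by (auto simp: Xeq e config_emb_def T_def)
    then show "\<exists>i j. i < j \<and> config_emb (X i) (X j)" using ij by (metis linorder_neqE_nat)
  qed
next
  case (Suc N)
  let ?A = "{(u, L, E). layered N u L E \<and> length L = Suc p \<and> (\<forall>j\<in>set L \<union> E. \<forall>i. u j i \<in> Q)}"
  show ?case unfolding almost_full_on_def
  proof (intro allI impI)
    fix X :: "nat \<Rightarrow> config"
    assume X: "\<forall>i. X i \<in> {(u, L, E). layered (Suc N) u L E \<and> length L = p \<and> (\<forall>j\<in>set L \<union> E. \<forall>i. u j i \<in> Q)}"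
    define u L E where "u = (\<lambda>i. fst (X i))" and "L = (\<lambda>i. fst (snd (X i)))" and "E = (\<lambda>i. snd (snd (X i)))"
    have Xeq: "X i = (u i, L i, E i)" for i by (simp add: u_def L_def E_def)
    have X': "layered (Suc N) (u i) (L i) (E i)" "length (L i) = p"
        "\<forall>j\<in>set (L i) \<union> E i. \<forall>r. u i j r \<in> Q" for i
      using X[rule_format, of i] unfolding Xeq by auto
    define parts where "parts i xs \<longleftrightarrow> xs \<noteq> [] \<and> E i = \<Union>(set (map snd xs)) \<and>
        direct_list (u i) (L i) (map snd xs) \<and>
        (\<forall>(a, F)\<in>set xs. a \<in> F \<and> layered N (u i) (a # L i) F)" for i xs
    have "\<forall>i. \<exists>xs. parts i xs" using X'(1) unfolding parts_def by simp
    then have "\<exists>xs. \<forall>i. parts i (xs i)" by (rule choice)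
    then obtain xs where "\<And>i. parts i (xs i)" by blast
    then have xs: "xs i \<noteq> []" "E i = \<Union>(set (map snd (xs i)))"
        "direct_list (u i) (L i) (map snd (xs i))"
        "\<And>a F. (a, F) \<in> set (xs i) \<Longrightarrow> a \<in> F \<and> layered N (u i) (a # L i) F" for i
      unfolding parts_def by blast+
    define g where "g i = (\<lambda>(a, F). (u i, a # L i, F :: nat set))" for i
    have "map (g i) (xs i) \<in> lists ?A" for i
    proof -
      have "g i x \<in> ?A" if "x \<in> set (xs i)" for x
      proof -
        obtain a F where x: "x = (a, F)" by fastforce
        have aF: "a \<in> F" "layered N (u i) (a # L i) F" using xs(4)[of a F i] that x by auto
        moreover have "F \<subseteq> E i" using that x by (subst xs(2)) force
        ultimately show ?thesis using X'(2,3)[of i] x by (auto simp: g_def)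
      qed
      then have "g i ` set (xs i) \<subseteq> ?A" by (rule image_subsetI)
      then show ?thesis unfolding lists_eq_set by simp
    qed
    then obtain i j where ij: "i < j" and emb: "list_emb config_emb (map (g i) (xs i)) (map (g j) (xs j))"
      by (rule almost_full_onD[OF almost_full_on_lists[OF Suc.IH[of "Suc p"]]])
    \<comment> \<open>The embedding of a part fixes its marked element as base vector; the marked
      element is dropped again to compare parts over the common base.\<close>
    have step: "config_emb (u i, L i, F) (u j, L j, F')" if "config_emb (g i (a, F)) (g j (a', F'))"
      for a F a' F'
      using that embeds_via_tl[of _ "u i" a "L i" F "u j" a' "L j" F']
      by (auto simp: g_def config_emb_def)
    have "list_emb (\<lambda>F F'. config_emb (u i, L i, F) (u j, L j, F')) (map snd ys) (map snd zs)"
      if "list_emb config_emb (map (g i) ys) (map (g j) zs)" for ys zs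
      using that
    proof (induction "map (g i) ys" "map (g j) zs" arbitrary: ys zs rule: list_emb.induct)
      case (list_emb_Cons Ys z)
      then obtain x zs' where "zs = x # zs'" "Ys = map (g j) zs'" by (auto simp: Cons_eq_map_conv)
      then show ?case using list_emb_Cons.hyps(2) by auto
    next
      case (list_emb_Cons2 y z Ys Zs)
      then obtain x ys' x' zs' where "ys = x # ys'" "zs = x' # zs'" "y = g i x" "z = g j x'"
          "Ys = map (g i) ys'" "Zs = map (g j) zs'"
        by (auto simp: Cons_eq_map_conv)
      then show ?case
        using list_emb_Cons2.hyps(1,3) step[of "fst x" "snd x" "fst x'" "snd x'"] by auto
    qed auto
    note emb' = this[OF emb]
    \<comment> \<open>Some part is embedded, and its embedding restricted to zero element
      coefficients matches the two bases.\<close>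
    have "snd (hd (xs i)) \<in> set (map snd (xs i))" using xs(1)[of i] by simp
    from list_emb_set[OF emb' this]
    obtain F F' where "config_emb (u i, L i, F) (u j, L j, F')" by metis
    then have "embeds_via id (u i) (L i) {} (u j) (L j) {}"
      by (auto simp: config_emb_def intro: embeds_via_base)
    moreover have "\<forall>F\<in>set (map snd (xs i)). finite F" for i
      by (auto dest!: xs(4) layered_finite)
    ultimately have "config_emb (X i) (X j)"
      unfolding Xeq xs(2) using emb' xs(3) by (intro config_emb_Union) auto
    then show "\<exists>i j. i < j \<and> config_emb (X i) (X j)" using ij by blast
  qed
qed

section \<open>From decompositions by elements to layered configurations\<close>

lemma direct_if_separates:
  assumes "separates (deps m A n (lspan (col m A) L)) E F" "E \<subseteq> {..<n}" "F \<subseteq> {..<n}"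
  shows "direct (col m A) L E F"
proof -
  have lc: "lc m A n (rs X \<alpha>) = lcs (col m A) X \<alpha>" if "X \<subseteq> {..<n}" for X \<alpha>
    using lc_rs[OF that] by (simp add: lcs_def)
  have "E \<union> F \<subseteq> {..<n}" using assms by blast
  then show ?thesis
    using assms(1) lc[OF assms(2)] lc[of "E \<union> F"] by (simp add: separates_def direct_def deps_def)
qed

lemma direct_assoc:
  assumes "direct u L E F" "direct u L (E \<union> F) G" shows "direct u L E (F \<union> G)"
proof -
  have "E \<inter> (F \<union> G) = {}" using assms by (auto simp: direct_def)
  moreover have "lcs u E \<alpha> \<in> lspan u L" if "lcs u (E \<union> (F \<union> G)) \<alpha> \<in> lspan u L" for \<alpha>
    using assms that by (simp add: direct_def Un_assoc)
  ultimately show ?thesis by (simp add: direct_def)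
qed

lemma direct_subset:
  assumes "direct u L E G" "E' \<subseteq> E" "finite E" "finite G" shows "direct u L E' G"
  unfolding direct_def
proof (intro conjI allI impI)
  show "E' \<inter> G = {}" using assms by (auto simp: direct_def)
  fix \<alpha> assume a: "lcs u (E' \<union> G) \<alpha> \<in> lspan u L"
  have "lcs u X (rs (E' \<union> G) \<alpha>) = lcs u (X \<inter> (E' \<union> G)) \<alpha>" if "finite X" for X
    using that unfolding lcs_def rs_def
    by (intro ext sum.mono_neutral_cong_right) auto
  moreover have "(E \<union> G) \<inter> (E' \<union> G) = E' \<union> G" "E \<inter> (E' \<union> G) = E'"
    using assms by (auto simp: direct_def)
  ultimately show "lcs u E' \<alpha> \<in> lspan u L"
    using assms a by (metis direct_def finite_Un)
qed

lemma direct_list_append: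
  assumes "direct_list u L Es" "direct_list u L Fs" "direct u L (\<Union>(set Es)) (\<Union>(set Fs))"
    "\<forall>E\<in>set Es. finite E" "\<forall>E\<in>set Fs. finite E"
  shows "direct_list u L (Es @ Fs)"
  using assms
proof (induction Es)
  case (Cons E Es)
  have "direct u L (\<Union>(set Es)) (\<Union>(set Fs))"
    using Cons.prems by (intro direct_subset[OF Cons.prems(3)]) auto
  moreover have "direct u L E (\<Union>(set Es) \<union> \<Union>(set Fs))"
    using Cons.prems by (intro direct_assoc) auto
  ultimately show ?case using Cons by simp
qed simp

text \<open>Padding: the element is contracted repeatedly until the prescribed depth is
  reached.\<close>

lemma layered_singleton: "layered N u L {e}"
proof (induction N arbitrary: L)
  case (Suc N)
  have "direct_list u L (map snd [(e, {e})])" by (simp add: direct_def)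
  then show ?case using Suc.IH[of "e # L"] by (force intro!: exI[of _ "[(e, {e})]"])
qed simp

lemma direct_list_singletons:
  assumes "distinct es" "\<forall>e\<in>set es. u e \<in> lspan u L"
  shows "direct_list u L (map (\<lambda>e. {e}) es)"
  using assms
proof (induction es)
  case (Cons e es)
  have "lcs u {e} \<alpha> \<in> lspan u L" for \<alpha>
    using Cons.prems subsp_scale[OF subsp_lspan] by (simp add: lcs_def)
  then show ?case using Cons by (auto simp: direct_def)
qed simp

lemma lc_unitv: "e < n \<Longrightarrow> lc m A n (unitv e) = col m A e"
  using lc_rs[of "{e}" n m A "unitv e"] by simp (simp add: unitv_def)

text \<open>A split concatenates lists of parts, and a contraction is a layer with one part. The
  extra layer in \<open>Suc N\<close> breaks a leaf into singletons, which form a direct sum because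
  their vectors lie in the span of the base.\<close>

lemma layered_if_edepth:
  assumes "edepth D E N" "D = deps m A n (lspan (col m A) L)" "E \<subseteq> {..<n}" "E \<noteq> {}"
  shows "layered (Suc N) (col m A) L E"
  using assms
proof (induction arbitrary: L rule: edepth.induct)
  case (leaf E D N)
  let ?es = "sorted_list_of_set E" and ?u = "col m A"
  have fin: "finite E" using leaf.prems finite_subset by blast
  have "\<forall>e\<in>set ?es. ?u e \<in> lspan ?u L"
  proof
    fix e assume "e \<in> set ?es"
    then have "e \<in> E" using fin by simp
    then have "lc m A n (unitv e) \<in> lspan ?u L" using leaf by (auto simp: deps_def)
    then show "?u e \<in> lspan ?u L" using lc_unitv \<open>e \<in> E\<close> leaf.prems(2) by auto
  qed
  then have dir: "direct_list ?u L (map (\<lambda>e. {e}) ?es)" by (intro direct_list_singletons) auto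
  show ?case unfolding layered.simps
  proof (intro exI[of _ "map (\<lambda>e. (e, {e})) ?es"] conjI)
    show "map (\<lambda>e. (e, {e})) ?es \<noteq> []" using fin leaf.prems(3) by simp
    show "E = \<Union>(set (map snd (map (\<lambda>e. (e, {e})) ?es)))" using fin by auto
    show "direct_list ?u L (map snd (map (\<lambda>e. (e, {e})) ?es))" using dir by (simp add: comp_def)
  qed (auto simp: layered_singleton)
next
  case (split D E1 E2 N)
  let ?u = "col m A"
  consider "E1 = {}" | "E2 = {}" | "E1 \<noteq> {}" "E2 \<noteq> {}" by blast
  then show ?case
  proof cases
    case 1
    then show ?thesis using split.IH(2)[OF split.prems(1)] split.prems by simp
  next
    case 2
    then show ?thesis using split.IH(1)[OF split.prems(1)] split.prems by simp
  next
    case 3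
    have l: "layered (Suc N) ?u L E1" "layered (Suc N) ?u L E2"
      using split.IH[OF split.prems(1)] split.prems 3 by auto
    obtain xs where xs: "xs \<noteq> []" "E1 = \<Union>(set (map snd xs))" "direct_list ?u L (map snd xs)"
        "\<forall>(a, F)\<in>set xs. a \<in> F \<and> layered N ?u (a # L) F" using l(1) unfolding layered.simps by blast
    obtain ys where ys: "ys \<noteq> []" "E2 = \<Union>(set (map snd ys))" "direct_list ?u L (map snd ys)"
        "\<forall>(a, F)\<in>set ys. a \<in> F \<and> layered N ?u (a # L) F" using l(2) unfolding layered.simps by blast
    have "direct ?u L E1 E2"
      using split.hyps(1) split.prems by (intro direct_if_separates) auto
    then have "direct_list ?u L (map snd xs @ map snd ys)"
      using xs(2,3) ys(2,3) layered_parts_finite[OF xs(4)] layered_parts_finite[OF ys(4)]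
      by (intro direct_list_append) simp_all
    then show ?thesis unfolding layered.simps
      using xs(1,2,4) ys(2,4) by (intro exI[of _ "xs @ ys"]) auto
  qed
next
  case (contract e E D N)
  let ?u = "col m A"
  have "Kplus D (unitv e) = deps m A n (lspan ?u (e # L))"
  proof -
    have "lc m A n (unitv e) = ?u e" using contract.hyps(1) contract.prems(2) by (intro lc_unitv) auto
    then show ?thesis
      using deps_Kplus[of m A n "lspan ?u L" "unitv e"] by (simp add: lspan_Cons contract.prems(1))
  qed
  then have "layered (Suc N) ?u (e # L) E" by (rule contract.IH[OF _ contract.prems(2,3)])
  moreover have "direct_list ?u L (map snd [(e, E)])"
    by (simp add: direct_def)
  ultimately show ?case
    unfolding layered.simps(2)[of "Suc N"] using contract.hyps(1) by (intro exI[of _ "[(e, E)]"]) auto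
qed

lemma csd_le_if_embeds_via:
  assumes "embeds_via \<iota> (col m A) [] E (col m' A') [] E'" "E \<subseteq> {..<n}" "E' \<subseteq> {..<n'}"
    "csd_le m' A' {\<lambda>i. 0} (\<iota> ` E) d"
  shows "csd_le m A {\<lambda>i. 0} E d"
proof -
  have inj: "inj_on \<iota> E" and im: "\<iota> ` E \<subseteq> {..<n'}"
    using assms(1,3) by (auto simp: embeds_via_def)
  have eq: "(\<forall>i. lcs (col m A) E \<alpha> i = 0) \<longleftrightarrow> (\<forall>i. lcs (\<lambda>e. col m' A' (\<iota> e)) E \<alpha> i = 0)" for \<alpha>
    using assms(1) by (auto simp: embeds_via_def lcl_def)
  have "rs (\<iota> ` E) \<alpha> \<in> deps m' A' n' {\<lambda>i. 0} \<longleftrightarrow> rs E (\<lambda>j. \<alpha> (\<iota> j)) \<in> deps m A n {\<lambda>i. 0}" for \<alpha>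
    using eq[of "\<lambda>j. \<alpha> (\<iota> j)"] lc_rs[OF im, of m' A' \<alpha>] lc_rs[OF assms(2), of m A "\<lambda>j. \<alpha> (\<iota> j)"]
    by (simp add: deps_def lcs_def sum.reindex[OF inj] fun_eq_iff)
  moreover have "cdepth (deps m' A' n' {\<lambda>i. 0}) (\<iota> ` E) d"
    using assms(4) csd_le_iff_cdepth[OF im] by simp
  ultimately have "cdepth (deps m A n {\<lambda>i. 0}) E d"
    using cdepth_pullback[OF _ subsp_deps[OF subsp_singleton_0] subsp_deps[OF subsp_singleton_0] inj refl]
    by blast
  then show ?thesis using csd_le_iff_cdepth[OF assms(2)] by simp
qed

subsection \<open>Critical matrices\<close>

lemma finite_bitlen_le: "finite {x. bitlen x \<le> k}"
proof (rule finite_subset)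
  show "{x. bitlen x \<le> k} \<subseteq> {- (2 ^ k) .. 2 ^ k}"
  proof
    fix x assume "x \<in> {x. bitlen x \<le> k}"
    then have "log 2 (real_of_int (\<bar>x\<bar> + 1)) \<le> real k" by (simp add: bitlen_def)
    then have "real_of_int (\<bar>x\<bar> + 1) \<le> 2 powr real k" by (subst (asm) log_le_iff) auto
    then have "real_of_int (\<bar>x\<bar> + 1) \<le> real_of_int (2 ^ k)" by (simp add: powr_realpow)
    then have "\<bar>x\<bar> + 1 \<le> 2 ^ k" by (simp only: of_int_le_iff)
    then show "x \<in> {- (2 ^ k) .. 2 ^ k}" by auto
  qed
qed simp

lemma finite_rat_enc_le: "finite {r. rat_enc r \<le> k}"
proof -
  have "quotient_of ` {r. rat_enc r \<le> k} \<subseteq> {x. bitlen x \<le> k} \<times> {x. bitlen x \<le> k}"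
  proof
    fix y assume "y \<in> quotient_of ` {r. rat_enc r \<le> k}"
    then obtain r where "y = quotient_of r" "rat_enc r \<le> k" by blast
    then show "y \<in> {x. bitlen x \<le> k} \<times> {x. bitlen x \<le> k}"
      by (cases "quotient_of r") (simp add: rat_enc_def)
  qed
  then have "finite (quotient_of ` {r. rat_enc r \<le> k})"
    by (rule finite_subset) (intro finite_cartesian_product finite_bitlen_le)
  moreover have "inj quotient_of" by (auto intro: injI simp: quotient_of_inject)
  ultimately show ?thesis using finite_imageD inj_on_subset[OF _ subset_UNIV] by (metis (no_types))
qed

lemma rat_enc_le_entry_complexity:
  assumes "i < m" "j < n" shows "rat_enc (A i j) \<le> entry_complexity m n A"
proof -
  have "{rat_enc (A i j) | i j. i < m \<and> j < n} = (\<lambda>(i, j). rat_enc (A i j)) ` ({..<m} \<times> {..<n})"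
    by auto
  then show ?thesis unfolding entry_complexity_def using assms by (intro Max_ge) auto
qed

lemma layered_if_csd:
  assumes "0 < n" shows "layered (Suc (elim_bound (csd m A {0..<n}))) (col m A) [] {0..<n}"
proof -
  have E: "{0..<n} \<subseteq> {..<n}" by auto
  have "cdepth (deps m A n {\<lambda>i. 0}) {0..<n} (csd m A {0..<n})"
    using csd_le_csd[of "{0..<n}" m A] csd_le_iff_cdepth[OF E] by simp
  then have "edepth (deps m A n {\<lambda>i. 0}) {0..<n} (elim_bound (csd m A {0..<n}))"
    by (intro edepth_if_cdepth subsp_deps subsp_singleton_0) auto
  then show ?thesis using E assms by (intro layered_if_edepth[of _ _ _ m A n]) (auto simp: lspan_Nil)
qed

definition critical :: "nat \<Rightarrow> nat \<Rightarrow> nat \<Rightarrow> nat \<Rightarrow> (nat \<Rightarrow> nat \<Rightarrow> rat) \<Rightarrow> bool" where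
  "critical d k m n A \<longleftrightarrow> entry_complexity m n A = k \<and> csd m A {0..<n} = d \<and>
     (\<forall>e<n. csd m A ({0..<n} - {e}) < d)"

text \<open>The image misses some element \<open>e\<close>, so the smaller matroid is isomorphic to
  a restriction of the larger one without \<open>e\<close> and has depth below
  \<open>d\<close>.\<close>

lemma critical_not_embeds:
  assumes "critical d k m n A" "critical d k' m' n' A'" "n < n'"
  shows "\<not> config_emb (col m A, [], {0..<n}) (col m' A', [], {0..<n'})"
proof
  assume "config_emb (col m A, [], {0..<n}) (col m' A', [], {0..<n'})"
  then obtain \<iota> where \<iota>: "embeds_via \<iota> (col m A) [] {0..<n} (col m' A') [] {0..<n'}"
    by (auto simp: config_emb_def)
  then have "card (\<iota> ` {0..<n}) \<le> n" "\<iota> ` {0..<n} \<subseteq> {0..<n'}"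
    using card_image_le[of "{0..<n}" \<iota>] by (auto simp: embeds_via_def)
  then have "\<iota> ` {0..<n} \<noteq> {0..<n'}" using assms(3) by auto
  then obtain e where "e \<in> {0..<n'}" "e \<notin> \<iota> ` {0..<n}"
    using \<open>\<iota> ` {0..<n} \<subseteq> {0..<n'}\<close> by blast
  then have e: "e < n'" "\<iota> ` {0..<n} \<subseteq> {0..<n'} - {e}"
    using \<open>\<iota> ` {0..<n} \<subseteq> {0..<n'}\<close> by auto
  let ?F = "{0..<n'} - {e}" and ?D = "deps m' A' n' {\<lambda>i. 0}"
  have F: "?F \<subseteq> {..<n'}" and im: "\<iota> ` {0..<n} \<subseteq> {..<n'}" using e by auto
  have "cdepth ?D ?F (csd m' A' ?F)" using csd_le_csd[of ?F] csd_le_iff_cdepth[OF F] by simp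
  then have "cdepth ?D (\<iota> ` {0..<n}) (csd m' A' ?F)" using cdepth_subset e(2) by blast
  then have "csd_le m' A' {\<lambda>i. 0} (\<iota> ` {0..<n}) (csd m' A' ?F)" using csd_le_iff_cdepth[OF im] by simp
  then have "csd_le m A {\<lambda>i. 0} {0..<n} (csd m' A' ?F)"
    using csd_le_if_embeds_via[OF \<iota>, of n n'] by (simp add: lessThan_atLeast0)
  then have "d \<le> csd m' A' ?F" using csd_leI assms(1) by (metis critical_def)
  then show False using assms(2) e(1) by (auto simp: critical_def)
qed

lemma finite_critical_sizes: "finite {n. \<exists>m A. critical d k m n A}"
proof (rule ccontr)
  let ?S = "{n. \<exists>m A. critical d k m n A}"
  assume inf: "infinite ?S"
  \<comment> \<open>Starting at \<open>Suc i\<close> skips the least size, so all chosen sizes are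
    positive, as layered configurations are nonempty.\<close>
  define s where "s i = enumerate ?S (Suc i)" for i
  have s_mono: "s i < s j" if "i < j" for i j
    using strict_monoD[OF strict_mono_enumerate[OF inf]] that by (simp add: s_def)
  have s_pos: "0 < s i" for i
    using strict_monoD[OF strict_mono_enumerate[OF inf], of 0 "Suc i"] by (simp add: s_def)
  have "\<forall>i. \<exists>mA. critical d k (fst mA) (s i) (snd mA)"
    using enumerate_in_set[OF inf] by (auto simp: s_def)
  then obtain mA where mA: "\<And>i. critical d k (fst (mA i)) (s i) (snd (mA i))" by metis
  define m A where "m = (\<lambda>i. fst (mA i))" and "A = (\<lambda>i. snd (mA i))"
  have crit: "critical d k (m i) (s i) (A i)" for i using mA by (simp add: m_def A_def)
  \<comment> \<open>The value 0 is added for the entries of \<open>col\<close> below the last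
    row.\<close>
  define Q where "Q = insert 0 {r. rat_enc r \<le> k}"
  have "finite Q" using finite_rat_enc_le by (simp add: Q_def)
  let ?X = "\<lambda>i. (col (m i) (A i), [] :: nat list, {0..<s i})"
  have entries: "col (m i) (A i) j r \<in> Q" if "j < s i" for i j r
    using rat_enc_le_entry_complexity[of r "m i" j "s i" "A i"] that crit[of i]
    by (auto simp: col_def Q_def critical_def)
  have "?X i \<in> {(u, L, E). layered (Suc (elim_bound d)) u L E \<and> length L = 0 \<and>
      (\<forall>j\<in>set L \<union> E. \<forall>i. u j i \<in> Q)}" for i
    using layered_if_csd[OF s_pos[of i], of "m i" "A i"] crit[of i] entries[of _ i]
    by (simp add: critical_def)
  then obtain i j where "i < j" "config_emb (?X i) (?X j)"
    by (rule almost_full_onD[OF almost_full_on_layered[OF \<open>finite Q\<close>]])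
  then show False using critical_not_embeds[OF crit crit s_mono] by blast
qed

theorem theorem14:
  shows "\<exists>f :: nat \<Rightarrow> nat \<Rightarrow> nat. \<forall>d k m n (A :: nat \<Rightarrow> nat \<Rightarrow> rat).
    entry_complexity m n A = k \<and>
    csd m A {0..<n} = d \<and>
    (\<forall>e<n. csd m A ({0..<n} - {e}) < d)
    \<longrightarrow> n \<le> f d k"
proof (intro exI[of _ "\<lambda>d k. Max {n. \<exists>m A. critical d k m n A}"] allI impI)
  \<comment> \<open>The bound is the largest critical size; \<open>Max\<close> is only evaluated
    where the given matrix witnesses that the set is nonempty.\<close>
  fix d k m n and A :: "nat \<Rightarrow> nat \<Rightarrow> rat"
  assume "entry_complexity m n A = k \<and> csd m A {0..<n} = d \<and>
    (\<forall>e<n. csd m A ({0..<n} - {e}) < d)"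
  then have "critical d k m n A" by (simp add: critical_def)
  then show "n \<le> Max {n. \<exists>m A. critical d k m n A}"
    by (intro Max_ge finite_critical_sizes) blast
qed

end
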